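(* Let $(V,b,m)$ be a weighted graph with heat kernel $p$, let $x_0\in V$, and let $(V^{\mathrm{sym}},b^{\mathrm{sym}},m^{\mathrm{sym}})$ be a weakly spherically symmetric graph with root $o$ and heat kernel $p^{\mathrm{sym}}$; write $p^{\mathrm{sym}}_t(r)=p^{\mathrm{sym}}_t(o,y)$ for $y\in S_r(o)\subset V^{\mathrm{sym}}$. If $(V,b,m)$ has stronger (respectively, weaker) curvature growth with respect to $x_0$ than $(V^{\mathrm{sym}},b^{\mathrm{sym}},m^{\mathrm{sym}})$, then for all $r\in\mathbb{N}_0$, $x\in S_r(x_0)\subset V$ and $t\ge0$, $$p^{\mathrm{sym}}_t(r)\ge p_t(x_0,x)\qquad\bigl(\text{respectively, } p^{\mathrm{sym}}_t(r)\le p_t(x_0,x)\bigr).$$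
   Context: A weighted graph $(V,b,m)$ (with zero potential) consists of a countably infinite set $V$, a map $m:V\to(0,\infty)$ (a measure of full support), and a symmetric map $b:V\times V\to[0,\infty)$ with zero diagonal. Write $x\sim y$ if $b(x,y)>0$. All weighted graphs are assumed connected (any two vertices are joined by a finite path of successive neighbors) and locally finite (each vertex has only finitely many neighbors). Let $d$ be the combinatorial graph metric. For a fixed vertex $x_0$ and $r\in\mathbb{N}_0=\{0,1,2,\dots\}$ put $S_r(x_0)=\{x:d(x,x_0)=r\}$, $S_{-1}=\emptyset$. For $x\in S_r(x_0)$ let $\kappa_{\pm}(x)=\frac1{m(x)}\sum_{y\in S_{r\pm1}(x_0)}b(x,y)$. The graph is weakly spherically symmetric with root $o$ if $\kappa_\pm$, computed with respect to $o$, depend only on $d(\cdot,o)$; in this case write $\kappa_\pm^{\mathrm{sym}}(r)$ for the values on $S_r(o)$. $(V,b,m)$ has stronger (respectively, weaker) curvature growth with respect to $x_0\in V$ than a weakly spherically symmetric graph $(V^{\mathrm{sym}},b^{\mathrm{sym}},m^{\mathrm{sym}})$ with root $o$ if $m(x_0)=m^{\mathrm{sym}}(o)$ and, for all $r\in\mathbb{N}_0$ and $x\in S_r(x_0)\subset V$, $\kappa_+(x)\ge\kappa_+^{\mathrm{sym}}(r)$ and $\kappa_-(x)\le\kappa_-^{\mathrm{sym}}(r)$ (respectively, $\kappa_+(x)\le\kappa_+^{\mathrm{sym}}(r)$ and $\kappa_-(x)\ge\kappa_-^{\mathrm{sym}}(r)$). On the real Hilbert space $\ell^2(V,m)$ with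 $\langle f,g\rangle=\sum_x f(x)g(x)m(x)$, let $Q(f,g)=\frac12\sum_{x,y}b(x,y)(f(x)-f(y))(g(x)-g(y))$ with domain $D(Q)$ equal to the closure of the finitely supported functions with respect to $\langle\cdot,\cdot\rangle+Q(\cdot,\cdot)$, and let $L$ be the associated non-negative selfadjoint operator. The heat kernel $p$ is determined by $e^{-tL}f(x)=\sum_y p_t(x,y)f(y)m(y)$ for $f\in\ell^2(V,m)$. On a weakly spherically symmetric graph with root $o$, $p^{\mathrm{sym}}_t(o,\cdot)$ depends only on the distance to $o$, so that $p^{\mathrm{sym}}_t(r)$ is well defined. *)

theory Defs
  imports "HOL-Analysis.Analysis"
begin

section \<open>Weighted graphs\<close>

text \<open>The vertex set is the whole type \<^typ>\<open>'v\<close>.\<close>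

definition edges :: "('v \<Rightarrow> 'v \<Rightarrow> real) \<Rightarrow> ('v \<times> 'v) set" where
  "edges b = {(x, y). b x y > 0}"

locale weighted_graph =
  fixes b :: "'v \<Rightarrow> 'v \<Rightarrow> real" and m :: "'v \<Rightarrow> real"
  assumes countable_vertices: "countable (UNIV :: 'v set)"
    and infinite_vertices: "infinite (UNIV :: 'v set)"
    and measure_pos: "m x > 0"
    and weight_nonneg: "b x y \<ge> 0"
    and weight_sym: "b x y = b y x"
    and weight_diag: "b x x = 0"
    and connected: "(x, y) \<in> (edges b)\<^sup>*"
    and locally_finite: "finite {y. b x y > 0}"

definition gdist :: "('v \<Rightarrow> 'v \<Rightarrow> real) \<Rightarrow> 'v \<Rightarrow> 'v \<Rightarrow> nat" where
  "gdist b x y = (LEAST n. (x, y) \<in> edges b ^^ n)"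

text \<open>The radius is an integer, so that the sphere of radius \<open>-1\<close> is empty.\<close>

definition gsphere :: "('v \<Rightarrow> 'v \<Rightarrow> real) \<Rightarrow> 'v \<Rightarrow> int \<Rightarrow> 'v set" where
  "gsphere b x0 r = {x. int (gdist b x x0) = r}"

text \<open>In a connected locally finite graph all spheres are finite, so the sums below are
  genuine finite sums.\<close>

definition kappa_plus :: "('v \<Rightarrow> 'v \<Rightarrow> real) \<Rightarrow> ('v \<Rightarrow> real) \<Rightarrow> 'v \<Rightarrow> 'v \<Rightarrow> real" where
  "kappa_plus b m x0 x = (1 / m x) * (\<Sum>y\<in>gsphere b x0 (int (gdist b x x0) + 1). b x y)"

definition kappa_minus :: "('v \<Rightarrow> 'v \<Rightarrow> real) \<Rightarrow> ('v \<Rightarrow> real) \<Rightarrow> 'v \<Rightarrow> 'v \<Rightarrow> real" where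
  "kappa_minus b m x0 x = (1 / m x) * (\<Sum>y\<in>gsphere b x0 (int (gdist b x x0) - 1). b x y)"

definition weakly_spherically_symmetric ::
    "('v \<Rightarrow> 'v \<Rightarrow> real) \<Rightarrow> ('v \<Rightarrow> real) \<Rightarrow> 'v \<Rightarrow> bool" where
  "weakly_spherically_symmetric b m z \<longleftrightarrow>
     weighted_graph b m \<and>
     (\<forall>x y. gdist b x z = gdist b y z \<longrightarrow>
        kappa_plus b m z x = kappa_plus b m z y \<and>
        kappa_minus b m z x = kappa_minus b m z y)"

text \<open>The second graph is meant to be weakly spherically symmetric with root \<open>z\<close>; the value
  of its \<open>\<kappa>\<^sub>\<plusminus>\<close> at radius \<open>r\<close> is then the value at any vertex \<open>y\<close> of the
  (nonempty) sphere of radius \<open>r\<close> about \<open>z\<close>.\<close>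

definition stronger_curvature_growth ::
    "('v \<Rightarrow> 'v \<Rightarrow> real) \<Rightarrow> ('v \<Rightarrow> real) \<Rightarrow> 'v \<Rightarrow>
     ('w \<Rightarrow> 'w \<Rightarrow> real) \<Rightarrow> ('w \<Rightarrow> real) \<Rightarrow> 'w \<Rightarrow> bool" where
  "stronger_curvature_growth b m x0 bs ms z \<longleftrightarrow>
     m x0 = ms z \<and>
     (\<forall>r::nat. \<forall>x\<in>gsphere b x0 (int r). \<forall>y\<in>gsphere bs z (int r).
        kappa_plus b m x0 x \<ge> kappa_plus bs ms z y \<and>
        kappa_minus b m x0 x \<le> kappa_minus bs ms z y)"

definition weaker_curvature_growth ::
    "('v \<Rightarrow> 'v \<Rightarrow> real) \<Rightarrow> ('v \<Rightarrow> real) \<Rightarrow> 'v \<Rightarrow>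
     ('w \<Rightarrow> 'w \<Rightarrow> real) \<Rightarrow> ('w \<Rightarrow> real) \<Rightarrow> 'w \<Rightarrow> bool" where
  "weaker_curvature_growth b m x0 bs ms z \<longleftrightarrow>
     m x0 = ms z \<and>
     (\<forall>r::nat. \<forall>x\<in>gsphere b x0 (int r). \<forall>y\<in>gsphere bs z (int r).
        kappa_plus b m x0 x \<le> kappa_plus bs ms z y \<and>
        kappa_minus b m x0 x \<ge> kappa_minus bs ms z y)"

section \<open>The Dirichlet form and its operator\<close>

text \<open>Since \<open>m\<close> is strictly positive, an element of \<open>\<ell>\<^sup>2(V, m)\<close> is an actual
  function on the vertices.\<close>

definition ell2 :: "('v \<Rightarrow> real) \<Rightarrow> ('v \<Rightarrow> real) set" where
  "ell2 m = {f. (\<lambda>x. (f x)\<^sup>2 * m x) summable_on UNIV}"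

definition ell2_inner :: "('v \<Rightarrow> real) \<Rightarrow> ('v \<Rightarrow> real) \<Rightarrow> ('v \<Rightarrow> real) \<Rightarrow> real" where
  "ell2_inner m f g = (\<Sum>\<^sub>\<infinity>x. f x * g x * m x)"

definition ell2_norm :: "('v \<Rightarrow> real) \<Rightarrow> ('v \<Rightarrow> real) \<Rightarrow> real" where
  "ell2_norm m f = sqrt (ell2_inner m f f)"

definition finite_energy :: "('v \<Rightarrow> 'v \<Rightarrow> real) \<Rightarrow> ('v \<Rightarrow> real) \<Rightarrow> bool" where
  "finite_energy b f \<longleftrightarrow> (\<lambda>(x, y). b x y * (f x - f y)\<^sup>2) summable_on UNIV"

definition dform :: "('v \<Rightarrow> 'v \<Rightarrow> real) \<Rightarrow> ('v \<Rightarrow> real) \<Rightarrow> ('v \<Rightarrow> real) \<Rightarrow> real" where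
  "dform b f g = 1 / 2 * (\<Sum>\<^sub>\<infinity>(x, y). b x y * (f x - f y) * (g x - g y))"

text \<open>The closure is taken inside the space of \<open>\<ell>\<^sup>2\<close> functions of finite energy. The
  energy condition has to be stated, because an infinite sum that does not converge is \<open>0\<close>
  by convention.\<close>

definition dform_domain ::
    "('v \<Rightarrow> 'v \<Rightarrow> real) \<Rightarrow> ('v \<Rightarrow> real) \<Rightarrow> ('v \<Rightarrow> real) set" where
  "dform_domain b m =
     {f \<in> ell2 m. finite_energy b f \<and>
        (\<forall>\<epsilon>>0. \<exists>\<phi>. finite {x. \<phi> x \<noteq> 0} \<and>
           ell2_inner m (\<lambda>x. f x - \<phi> x) (\<lambda>x. f x - \<phi> x)
             + dform b (\<lambda>x. f x - \<phi> x) (\<lambda>x. f x - \<phi> x) < \<epsilon>)}"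

text \<open>The selfadjoint operator associated with a closed form: \<open>f\<close> is in its domain, with
  value \<open>g\<close>, iff \<open>f\<close> is in the form domain and \<open>Q(f, h) = \<langle>g, h\<rangle>\<close> for
  all \<open>h\<close> in the form domain.\<close>

definition lap_domain ::
    "('v \<Rightarrow> 'v \<Rightarrow> real) \<Rightarrow> ('v \<Rightarrow> real) \<Rightarrow> ('v \<Rightarrow> real) set" where
  "lap_domain b m =
     {f \<in> dform_domain b m. \<exists>g\<in>ell2 m. \<forall>h\<in>dform_domain b m. dform b f h = ell2_inner m g h}"

definition lap ::
    "('v \<Rightarrow> 'v \<Rightarrow> real) \<Rightarrow> ('v \<Rightarrow> real) \<Rightarrow> ('v \<Rightarrow> real) \<Rightarrow> 'v \<Rightarrow> real" where
  "lap b m f =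
     (THE g. g \<in> ell2 m \<and> (\<forall>h\<in>dform_domain b m. dform b f h = ell2_inner m g h))"

section \<open>Heat semigroup and heat kernel\<close>

definition C0_semigroup_ell2 ::
    "('v \<Rightarrow> real) \<Rightarrow> (real \<Rightarrow> ('v \<Rightarrow> real) \<Rightarrow> 'v \<Rightarrow> real) \<Rightarrow> bool" where
  "C0_semigroup_ell2 m T \<longleftrightarrow>
     (\<forall>t\<ge>0. \<forall>f\<in>ell2 m. T t f \<in> ell2 m) \<and>
     (\<forall>t\<ge>0. \<forall>f\<in>ell2 m. \<forall>g\<in>ell2 m. \<forall>\<alpha> \<beta>.
        T t (\<lambda>x. \<alpha> * f x + \<beta> * g x) = (\<lambda>x. \<alpha> * T t f x + \<beta> * T t g x)) \<and>
     (\<forall>t\<ge>0. \<exists>C. \<forall>f\<in>ell2 m. ell2_norm m (T t f) \<le> C * ell2_norm m f) \<and>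
     (\<forall>f\<in>ell2 m. T 0 f = f) \<and>
     (\<forall>s\<ge>0. \<forall>t\<ge>0. \<forall>f\<in>ell2 m. T (s + t) f = T s (T t f)) \<and>
     (\<forall>f\<in>ell2 m. ((\<lambda>t. ell2_norm m (\<lambda>x. T t f x - f x)) \<longlongrightarrow> 0) (at_right 0))"

definition generator_at ::
    "('v \<Rightarrow> real) \<Rightarrow> (real \<Rightarrow> ('v \<Rightarrow> real) \<Rightarrow> 'v \<Rightarrow> real) \<Rightarrow> ('v \<Rightarrow> real) \<Rightarrow> ('v \<Rightarrow> real) \<Rightarrow> bool" where
  "generator_at m T f g \<longleftrightarrow>
     ((\<lambda>t. ell2_norm m (\<lambda>x. (T t f x - f x) / t - g x)) \<longlongrightarrow> 0) (at_right 0)"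

text \<open>\<open>T\<close> is \<open>t \<mapsto> e\<^sup>-\<^sup>t\<^sup>L\<close>: the strongly continuous semigroup whose generator,
  including its domain, is \<open>-L\<close>.\<close>

definition heat_semigroup ::
    "('v \<Rightarrow> 'v \<Rightarrow> real) \<Rightarrow> ('v \<Rightarrow> real) \<Rightarrow>
     (real \<Rightarrow> ('v \<Rightarrow> real) \<Rightarrow> 'v \<Rightarrow> real) \<Rightarrow> bool" where
  "heat_semigroup b m T \<longleftrightarrow>
     C0_semigroup_ell2 m T \<and>
     (\<forall>f\<in>ell2 m. \<forall>g\<in>ell2 m.
        generator_at m T f g \<longleftrightarrow> f \<in> lap_domain b m \<and> g = (\<lambda>x. - lap b m f x))"

definition heat_kernel ::
    "('v \<Rightarrow> 'v \<Rightarrow> real) \<Rightarrow> ('v \<Rightarrow> real) \<Rightarrow> (real \<Rightarrow> 'v \<Rightarrow> 'v \<Rightarrow> real) \<Rightarrow> bool" where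
  "heat_kernel b m p \<longleftrightarrow>
     (\<exists>T. heat_semigroup b m T \<and>
        (\<forall>t\<ge>0. \<forall>f\<in>ell2 m. \<forall>x. ((\<lambda>y. p t x y * f y * m y) has_sum T t f x) UNIV))"

end

theory Submission
  imports Defs
begin

text \<open>
  Let \<open>u\<^sub>t(x)\<close> and \<open>v\<^sub>t(y)\<close> be the heat flows on the two graphs started at the point masses in the
  two centres, and write \<open>|x|\<close>, \<open>|y|\<close> for the distances to these centres. Suppose the first graph has
  the stronger curvature growth. The claim is the maximum principle for the pairs \<open>(x, y)\<close> with
  \<open>|y| \<le> |x|\<close>: on them \<open>u\<^sub>t(x) \<le> v\<^sub>t(y)\<close>. To see why, put \<open>g(r) = min {v\<^sub>t(y). |y| \<le> r}\<close>, a
  function that decreases in \<open>r\<close> by construction, and look at a pair where \<open>v\<^sub>t(y) - u\<^sub>t(x)\<close> is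
  minimal and negative, with \<open>|x| = r\<close>. Then \<open>v\<^sub>t(y) = g(r)\<close>, and the increments of \<open>u\<^sub>t\<close> at \<open>x\<close>
  lie below those of \<open>g(|\<cdot>|)\<close> while the increments of \<open>v\<^sub>t\<close> at \<open>y\<close> lie above them. If \<open>|y| = r\<close>,
  the heat equation turns this into
  \<open>u' \<le> \<kappa>\<^sub>+(x) (g(r+1) - g(r)) + \<kappa>\<^sub>-(x) (g(r-1) - g(r))
     \<le> \<kappa>\<^sub>+(y) (g(r+1) - g(r)) + \<kappa>\<^sub>-(y) (g(r-1) - g(r)) \<le> v'\<close>,
  because \<open>g(r+1) - g(r) \<le> 0 \<le> g(r-1) - g(r)\<close>; if \<open>|y| < r\<close>, both \<open>u' \<le> 0\<close> and \<open>v' \<ge> 0\<close> are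
  immediate. So the difference cannot decrease further. This is
  \<open>dirichlet_solution_le_heat\<close>. The weaker case of the theorem is the stronger case with the two
  graphs exchanged.

  The maximum principle applies to finitely many pairs only, so \<open>u\<close> is replaced by the solution
  \<open>w\<close> of the heat equation on a finite set \<open>K\<close> with Dirichlet boundary values. Such solutions
  approximate \<open>u\<close> (\<open>galerkin\<close>): the finitely supported functions are dense in the form domain, and
  since \<open>w\<close> and \<open>u\<close> solve the same equation when tested with functions supported in \<open>K\<close>, the
  derivative of \<open>\<parallel>u - w\<parallel>\<^sup>2\<close> is controlled by the distance, in form norm, from \<open>u\<close> to such functions.
  The same approximation gives \<open>v \<ge> 0\<close>.

  That \<open>u\<close> is differentiable from both sides is a statement about strongly continuous semigroups
  and rests on their local boundedness in time, which is obtained from the Baire property of the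
  real line (\<open>locally_bounded\<close>). Finally \<open>p\<^sub>t(x\<^sub>0, x) = u\<^sub>t(x) / m(x\<^sub>0)\<close> holds by symmetry of the
  semigroup (\<open>kernel_eq\<close>).
\<close>

section \<open>The space of square-summable functions\<close>

lemma summable_on_real_bound:
  fixes f g :: "'a \<Rightarrow> real"
  assumes "g summable_on A" and "\<And>x. x \<in> A \<Longrightarrow> \<bar>f x\<bar> \<le> g x"
  shows "f summable_on A"
proof -
  have "(\<lambda>x. norm (f x)) summable_on A"
    using assms by (intro Infinite_Sum.abs_summable_on_comparison_test') auto
  then show ?thesis by (rule summable_on_iff_abs_summable_on_real[THEN iffD2])
qed

text \<open>
  Wrapping \<open>\<ell>\<^sup>2\<close> in a type makes it an instance of \<^class>\<open>real_inner\<close>, so that Cauchy-Schwarz and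
  the calculus of vector-valued functions of time apply. Functions on the vertices and their
  differences along the edges both embed into such a type, after multiplication by the square root
  of \<open>m\<close> or \<open>b\<close>.
\<close>
typedef 'a l2 = "{f :: 'a \<Rightarrow> real. (\<lambda>x. (f x)\<^sup>2) summable_on UNIV}"
  morphisms l2_fun Abs_l2
  by (rule exI[of _ "\<lambda>_. 0"]) simp

setup_lifting type_definition_l2

lemma square_summable_add:
  fixes f g :: "'a \<Rightarrow> real"
  assumes "(\<lambda>x. (f x)\<^sup>2) summable_on UNIV" "(\<lambda>x. (g x)\<^sup>2) summable_on UNIV"
  shows "(\<lambda>x. (f x + g x)\<^sup>2) summable_on UNIV"
proof (rule summable_on_real_bound)
  show "(\<lambda>x. 2 * (f x)\<^sup>2 + 2 * (g x)\<^sup>2) summable_on UNIV"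
    by (intro summable_on_add summable_on_cmult_right assms)
  fix x show "\<bar>(f x + g x)\<^sup>2\<bar> \<le> 2 * (f x)\<^sup>2 + 2 * (g x)\<^sup>2"
  proof -
    have "(f x + g x)\<^sup>2 \<le> 2 * (f x)\<^sup>2 + 2 * (g x)\<^sup>2"
      using sum_squares_bound[of "f x" "g x"] by (simp add: power2_sum)
    then show ?thesis by simp
  qed
qed

lemma square_summable_mult:
  fixes f g :: "'a \<Rightarrow> real"
  assumes "(\<lambda>x. (f x)\<^sup>2) summable_on UNIV" "(\<lambda>x. (g x)\<^sup>2) summable_on UNIV"
  shows "(\<lambda>x. f x * g x) summable_on UNIV"
proof (rule summable_on_real_bound)
  show "(\<lambda>x. (f x)\<^sup>2 + (g x)\<^sup>2) summable_on UNIV"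
    by (intro summable_on_add assms)
  fix x show "\<bar>f x * g x\<bar> \<le> (f x)\<^sup>2 + (g x)\<^sup>2"
  proof -
    have "0 \<le> \<bar>f x\<bar> * \<bar>g x\<bar>" by simp
    moreover have "2 * (\<bar>f x\<bar> * \<bar>g x\<bar>) \<le> (f x)\<^sup>2 + (g x)\<^sup>2"
      using sum_squares_bound[of "\<bar>f x\<bar>" "\<bar>g x\<bar>"] by (simp only: mult.assoc power2_abs)
    ultimately show ?thesis unfolding abs_mult by linarith
  qed
qed

instantiation l2 :: (type) real_inner
begin

lift_definition zero_l2 :: "'a l2" is "\<lambda>_. 0" by simp
lift_definition plus_l2 :: "'a l2 \<Rightarrow> 'a l2 \<Rightarrow> 'a l2" is "\<lambda>f g x. f x + g x"
  by (rule square_summable_add)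
lift_definition uminus_l2 :: "'a l2 \<Rightarrow> 'a l2" is "\<lambda>f x. - f x" by simp
lift_definition minus_l2 :: "'a l2 \<Rightarrow> 'a l2 \<Rightarrow> 'a l2" is "\<lambda>f g x. f x - g x"
  using square_summable_add[of _ "\<lambda>x. - g x" for g] by fastforce
lift_definition scaleR_l2 :: "real \<Rightarrow> 'a l2 \<Rightarrow> 'a l2" is "\<lambda>r f x. r * f x"
  by (simp add: power_mult_distrib summable_on_cmult_right)
lift_definition inner_l2 :: "'a l2 \<Rightarrow> 'a l2 \<Rightarrow> real" is "\<lambda>f g. \<Sum>\<^sub>\<infinity>x. f x * g x" .

definition norm_l2 :: "'a l2 \<Rightarrow> real" where "norm_l2 f = sqrt (inner f f)"
definition sgn_l2 :: "'a l2 \<Rightarrow> 'a l2" where "sgn_l2 f = scaleR (inverse (norm f)) f"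
definition dist_l2 :: "'a l2 \<Rightarrow> 'a l2 \<Rightarrow> real" where "dist_l2 f g = norm (f - g)"
definition uniformity_l2 :: "('a l2 \<times> 'a l2) filter" where
  "uniformity_l2 = (INF e\<in>{0<..}. principal {(f, g). dist f g < e})"
definition open_l2 :: "'a l2 set \<Rightarrow> bool" where
  "open_l2 U \<longleftrightarrow> (\<forall>f\<in>U. eventually (\<lambda>(f', g). f' = f \<longrightarrow> g \<in> U) uniformity)"

instance
proof
  fix f g h :: "'a l2" and r s :: real and U :: "'a l2 set"
  show "f + g + h = f + (g + h)" by transfer (simp add: add.assoc)
  show "f + g = g + f" by transfer (simp add: add.commute)
  show "0 + f = f" by transfer simp
  show "- f + f = 0" by transfer simp
  show "f - g = f + - g" by transfer simp
  show "r *\<^sub>R (f + g) = r *\<^sub>R f + r *\<^sub>R g" by transfer (simp add: algebra_simps)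
  show "(r + s) *\<^sub>R f = r *\<^sub>R f + s *\<^sub>R f" by transfer (simp add: algebra_simps)
  show "r *\<^sub>R s *\<^sub>R f = (r * s) *\<^sub>R f" by transfer (simp add: algebra_simps)
  show "1 *\<^sub>R f = f" by transfer simp
  show "sgn f = scaleR (inverse (norm f)) f" by (rule sgn_l2_def)
  show "dist f g = norm (f - g)" by (rule dist_l2_def)
  show "uniformity = (INF e\<in>{0<..}. principal {(f::'a l2, g). dist f g < e})"
    by (rule uniformity_l2_def)
  show "open U \<longleftrightarrow> (\<forall>f\<in>U. \<forall>\<^sub>F (f', g) in uniformity. f' = f \<longrightarrow> g \<in> U)"
    by (rule open_l2_def)
  show "inner f g = inner g f" by transfer (simp add: mult.commute)
  show "inner (f + g) h = inner f h + inner g h"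
    by transfer (simp add: distrib_right infsum_add square_summable_mult)
  show "inner (r *\<^sub>R f) g = r * inner f g"
    by transfer (simp add: mult.assoc infsum_cmult_right')
  show "0 \<le> inner f f" by transfer (simp add: infsum_nonneg)
  show "inner f f = 0 \<longleftrightarrow> f = 0"
  proof
    assume "inner f f = 0"
    then show "f = 0"
    proof transfer
      fix f :: "'a \<Rightarrow> real"
      assume f: "(\<lambda>x. (f x)\<^sup>2) summable_on UNIV" "(\<Sum>\<^sub>\<infinity>x. f x * f x) = 0"
      have "f x * f x = 0" for x
      proof (rule nonneg_infsum_le_0D[of "\<lambda>x. f x * f x" UNIV])
        show "(\<lambda>x. f x * f x) summable_on UNIV" using f(1) by (simp only: power2_eq_square)
      qed (simp_all add: f(2))
      then show "f = (\<lambda>_. 0)" by auto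
    qed
  next
    assume "f = 0" then show "inner f f = 0" by transfer simp
  qed
  show "norm f = sqrt (inner f f)" by (rule norm_l2_def)
qed

end

lemma abs_l2_fun_le_norm: "\<bar>l2_fun f x\<bar> \<le> norm f"
proof -
  have "(\<lambda>y. (l2_fun f y)\<^sup>2) summable_on UNIV" using l2_fun[of f] by simp
  then have "(\<Sum>y\<in>{x}. (l2_fun f y)\<^sup>2) \<le> (\<Sum>\<^sub>\<infinity>y. (l2_fun f y)\<^sup>2)"
    by (intro finite_sum_le_infsum) auto
  moreover have "(norm f)\<^sup>2 = (\<Sum>\<^sub>\<infinity>y. (l2_fun f y)\<^sup>2)"
    unfolding power2_norm_eq_inner inner_l2.rep_eq by (simp add: power2_eq_square)
  ultimately have "\<bar>l2_fun f x\<bar>\<^sup>2 \<le> (norm f)\<^sup>2" by simp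
  then show ?thesis by (rule power2_le_imp_le) simp
qed

lemma bounded_linear_l2_fun: "bounded_linear (\<lambda>f. l2_fun f x)"
  by (rule bounded_linear_intro[of _ 1])
    (auto simp: plus_l2.rep_eq scaleR_l2.rep_eq abs_l2_fun_le_norm)

section \<open>Strongly continuous semigroups\<close>

locale c0_semigroup =
  fixes S :: "real \<Rightarrow> 'a::real_normed_vector \<Rightarrow> 'a"
  assumes bounded_linear: "t \<ge> 0 \<Longrightarrow> bounded_linear (S t)"
    and zero: "S 0 f = f"
    and add: "s \<ge> 0 \<Longrightarrow> t \<ge> 0 \<Longrightarrow> S (s + t) f = S s (S t f)"
    and continuous_at_zero: "((\<lambda>t. S t f) \<longlongrightarrow> f) (at_right 0)"
begin

lemma right_continuous:
  assumes "t \<ge> 0"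
  shows "((\<lambda>s. S s f) \<longlongrightarrow> S t f) (at_right t)"
proof -
  interpret St: bounded_linear "S t" by (rule bounded_linear[OF assms])
  have "((\<lambda>h. S t (S h f)) \<longlongrightarrow> S t f) (at_right 0)"
    by (rule St.tendsto[OF continuous_at_zero])
  moreover have "\<forall>\<^sub>F h in at_right 0. S t (S h f) = S (h + t) f"
    using eventually_at_right_less by eventually_elim (metis add add.commute assms less_imp_le)
  ultimately have "((\<lambda>h. S (h + t) f) \<longlongrightarrow> S t f) (at_right 0)"
    by (rule Lim_transform_eventually)
  then show ?thesis
    unfolding filterlim_at_right_to_0[of "\<lambda>s. S s f" _ t] .
qed

text \<open>
  The set of times \<open>s\<close> with \<open>\<parallel>S s\<parallel> \<le> k\<close> is closed under limits from the right. By Baire's theorem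
  one of these sets is dense in some interval arbitrarily close to \<open>0\<close>, hence contains that interval.
  Composing with one further operator \<open>S \<tau>\<close> moves the interval to any prescribed \<open>t > 0\<close>.
\<close>
lemma locally_bounded:
  assumes "t > 0"
  obtains c d k where "c < t" "t < d" "c \<ge> 0" "k \<ge> 0"
    "\<And>s f. c < s \<Longrightarrow> s < d \<Longrightarrow> norm (S s f) \<le> k * norm f"
proof -
  define A where "A k = {s. s \<ge> 0 \<and> (\<forall>f. norm (S s f) \<le> real k * norm f)}" for k :: nat
  have cover: "\<exists>k. s \<in> A k" if s: "s \<ge> 0" for s
  proof -
    obtain B where B: "\<And>f. norm (S s f) \<le> norm f * B"
      using bounded_linear.bounded[OF bounded_linear[OF s]] by blast
    obtain k :: nat where k: "B \<le> real k" using real_arch_simple by blast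
    have "norm (S s f) \<le> real k * norm f" for f
      using B[of f] mult_left_mono[OF k norm_ge_zero[of f]] by (simp add: mult.commute)
    then show ?thesis using s by (auto simp: A_def)
  qed
  let ?I = "{t/4..t/2}"
  have "\<exists>k. \<not> ?I \<subseteq> closure (?I - closure (A k))"
  proof (rule ccontr)
    assume "\<not> ?thesis"
    then have all: "?I \<subseteq> closure (?I - closure (A k))" for k by blast
    have "?I \<subseteq> closure (\<Inter> (range (\<lambda>k. ?I - closure (A k))))"
      by (rule Baire) (use all in \<open>auto simp: Diff_eq intro!: openin_open_Int\<close>)
    moreover have "\<Inter> (range (\<lambda>k. ?I - closure (A k))) = {}"
    proof -
      have False if "\<And>k. s \<in> ?I - closure (A k)" for s
      proof -
        have "s \<ge> 0" using that[of 0] assms by auto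
        then obtain k where "s \<in> A k" using cover by blast
        then show False using that[of k] closure_subset by blast
      qed
      then show ?thesis by blast
    qed
    ultimately have "?I \<subseteq> closure {}" by (simp only:)
    then show False using assms by simp
  qed
  then obtain k x where x: "x \<in> ?I" "x \<notin> closure (?I - closure (A k))" by blast
  then obtain e where e: "e > 0" "\<And>y. y \<in> ?I - closure (A k) \<Longrightarrow> \<not> dist y x < e"
    unfolding closure_approachable by blast
  define c where "c = max (t/4) (x - e)"
  define d where "d = min (t/2) (x + e)"
  have cd: "c < d" "c \<ge> 0" "d \<le> t/2" using x(1) e(1) assms
    by (auto simp: c_def d_def max_def min_def)
  have clo: "s \<in> closure (A k)" if "c < s" "s < d" for s
    using e(2)[of s] that by (auto simp: c_def d_def dist_real_def abs_less_iff)
  \<comment> \<open>a bound that holds on a dense set of times propagates by right limits\<close>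
  have bound: "norm (S s f) \<le> real k * norm f" if s: "c < s" "s < d" for s f
  proof (rule ccontr)
    assume "\<not> ?thesis"
    then have "\<forall>\<^sub>F r in at_right s. norm (S r f) > real k * norm f"
      using order_tendstoD(1)[OF tendsto_norm[OF right_continuous[of s f]]] s cd by auto
    then obtain b where b: "b > s" "\<And>r. s < r \<Longrightarrow> r < b \<Longrightarrow> norm (S r f) > real k * norm f"
      unfolding eventually_at_right_field by blast
    let ?r = "(s + min b d) / 2"
    have r: "s < ?r" "?r < min b d" using b s by auto
    then have "?r \<in> closure (A k)" using clo s by auto
    then obtain r' where "r' \<in> A k" "dist r' ?r < (min b d - s) / 2"
      unfolding closure_approachable using r by (metis diff_gt_0_iff_gt half_gt_zero less_trans)
    then have "s < r'" "r' < b" "norm (S r' f) \<le> real k * norm f"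
      by (auto simp: dist_real_def A_def abs_less_iff field_simps)
    with b(2)[of r'] show False by auto
  qed
  (* shifting by \<tau> centres the interval at t *)
  define \<tau> where "\<tau> = t - (c + d) / 2"
  have \<tau>: "\<tau> \<ge> 0" using cd assms by (auto simp: \<tau>_def)
  obtain B where B: "B \<ge> 0" "\<And>f. norm (S \<tau> f) \<le> norm f * B"
    using bounded_linear.nonneg_bounded[OF bounded_linear[OF \<tau>]] by blast
  show thesis
  proof (rule that[of "\<tau> + c" "\<tau> + d" "real k * B"])
    fix s f assume s: "\<tau> + c < s" "s < \<tau> + d"
    have "S s f = S \<tau> (S (s - \<tau>) f)" using add[of \<tau> "s - \<tau>" f] s \<tau> cd by simp
    then have "norm (S s f) \<le> norm (S (s - \<tau>) f) * B" using B by simp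
    also have "\<dots> \<le> (real k * norm f) * B"
      by (rule mult_right_mono[OF bound]) (use s B in auto)
    finally show "norm (S s f) \<le> real k * B * norm f" by (simp add: mult_ac)
  qed (use cd \<tau> B in \<open>auto simp: \<tau>_def\<close>)
qed

text \<open>
  Continuity at \<open>0\<close> gives \<open>S t f - S (t - h) f = S (t - h) (S h f - f)\<close>, a small vector under an
  operator that varies with \<open>h\<close>; local boundedness makes the result small.
\<close>
lemma left_continuous:
  assumes "t > 0"
  shows "((\<lambda>s. S s f) \<longlongrightarrow> S t f) (at_left t)"
proof -
  obtain c d k where k: "c < t" "t < d" "c \<ge> 0" "k \<ge> 0"
    "\<And>s f. c < s \<Longrightarrow> s < d \<Longrightarrow> norm (S s f) \<le> k * norm f"
    using locally_bounded[OF assms] by blast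
  have "((\<lambda>h. k * norm (f - S h f)) \<longlongrightarrow> k * norm (f - f)) (at_right 0)"
    by (intro tendsto_intros continuous_at_zero)
  then have "((\<lambda>h. k * norm (f - S h f)) \<longlongrightarrow> 0) (at_right 0)" by simp
  moreover have "\<forall>\<^sub>F h in at_right 0. h > 0 \<and> h < t - c"
    using k by (auto simp: eventually_at_right_field intro!: exI[of _ "t - c"])
  then have "\<forall>\<^sub>F h in at_right 0. norm (S (t - h) f - S t f) \<le> k * norm (f - S h f)"
  proof eventually_elim
    case (elim h)
    interpret Sh: bounded_linear "S (t - h)" by (rule bounded_linear) (use elim k in simp)
    have "S t f = S (t - h) (S h f)" using add[of "t - h" h f] elim k by simp
    then have "S (t - h) f - S t f = S (t - h) (f - S h f)" by (simp add: Sh.diff)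
    then show ?case using k(5)[of "t - h" "f - S h f"] elim k by simp
  qed
  ultimately have "((\<lambda>h. S (t - h) f - S t f) \<longlongrightarrow> 0) (at_right 0)"
    by (rule Lim_null_comparison[rotated])
  then have "((\<lambda>h. S (t - h) f) \<longlongrightarrow> S t f) (at_right 0)" by (simp add: LIM_zero_iff)
  then have "((\<lambda>h. S (t + h) f) \<longlongrightarrow> S t f) (at_left 0)"
    unfolding filterlim_at_left_to_right by simp
  moreover have "at_left t = filtermap (\<lambda>h. t + h) (at_left 0)"
    using filtermap_at_left_shift[of "-t" 0] by (simp add: add.commute)
  ultimately show ?thesis by (simp add: filterlim_filtermap)
qed

lemma isCont: "t > 0 \<Longrightarrow> isCont (\<lambda>s. S s f) t"
  unfolding isCont_def by (intro filterlim_split_at left_continuous right_continuous) auto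

lemma continuous_on: "continuous_on {0..} (\<lambda>t. S t f)"
  unfolding continuous_on_def
proof
  fix t :: real assume "t \<in> {0..}"
  then consider "t = 0" | "t > 0" by fastforce
  then show "((\<lambda>s. S s f) \<longlongrightarrow> S t f) (at t within {0..})"
  proof cases
    case 1 then show ?thesis using right_continuous[of 0 f] by (simp add: at_within_Ici_at_right)
  next
    case 2
    show ?thesis
      by (rule tendsto_within_subset[OF isCont[OF 2, unfolded isCont_def] subset_UNIV])
  qed
qed

definition generates :: "'a \<Rightarrow> 'a \<Rightarrow> bool" where
  "generates f g \<longleftrightarrow> ((\<lambda>h. (S h f - f) /\<^sub>R h) \<longlongrightarrow> g) (at_right 0)"

text \<open>
  \<open>S t\<close> commutes with the difference quotients at \<open>0\<close>, so it preserves the domain of the generator.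
\<close>
lemma generates_shift:
  assumes "generates f g" and t: "t \<ge> 0"
  shows "generates (S t f) (S t g)"
proof -
  interpret St: bounded_linear "S t" by (rule bounded_linear[OF t])
  have "((\<lambda>h. S t ((S h f - f) /\<^sub>R h)) \<longlongrightarrow> S t g) (at_right 0)"
    using assms(1) unfolding generates_def by (rule St.tendsto)
  moreover have "\<forall>\<^sub>F h in at_right 0. S t ((S h f - f) /\<^sub>R h) = (S h (S t f) - S t f) /\<^sub>R h"
    using eventually_at_right_less
  proof eventually_elim
    case (elim h)
    have "S t (S h f) = S h (S t f)" using add[of t h f] add[of h t f] elim t by (simp add: add.commute)
    then show ?case by (simp add: St.scaleR St.diff)
  qed
  ultimately show ?thesis unfolding generates_def by (rule Lim_transform_eventually)
qed

text \<open>
  The derivative from the right is \<open>generates_shift\<close>. For the one from the left, \<open>S (t - h)\<close> is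
  applied to the difference quotient at \<open>0\<close>, and local boundedness is used again.
\<close>
lemma has_vector_derivative:
  assumes gen: "generates f g" and t: "t > 0"
  shows "((\<lambda>s. S s f) has_vector_derivative S t g) (at t)"
proof -
  obtain c d k where k: "c < t" "t < d" "c \<ge> 0" "k \<ge> 0"
    "\<And>s f. c < s \<Longrightarrow> s < d \<Longrightarrow> norm (S s f) \<le> k * norm f"
    using locally_bounded[OF t] by blast
  have right: "((\<lambda>h. (S (t + h) f - S t f) /\<^sub>R h) \<longlongrightarrow> S t g) (at_right 0)"
  proof (rule Lim_transform_eventually)
    show "((\<lambda>h. (S h (S t f) - S t f) /\<^sub>R h) \<longlongrightarrow> S t g) (at_right 0)"
      using generates_shift[OF gen, of t] t by (simp add: generates_def)
    show "\<forall>\<^sub>F h in at_right 0. (S h (S t f) - S t f) /\<^sub>R h = (S (t + h) f - S t f) /\<^sub>R h"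
      using eventually_at_right_less
      by eventually_elim (use add[of _ t f] t in \<open>simp add: add.commute\<close>)
  qed
  have "((\<lambda>h. (S (t - h) f - S t f) /\<^sub>R (- h)) \<longlongrightarrow> S t g) (at_right 0)"
  proof -
    have "((\<lambda>h. k * norm ((S h f - f) /\<^sub>R h - g) + norm (S (t - h) g - S t g))
        \<longlongrightarrow> k * norm (g - g) + norm (S t g - S t g)) (at_right 0)"
    proof (intro tendsto_intros)
      show "((\<lambda>h. (S h f - f) /\<^sub>R h) \<longlongrightarrow> g) (at_right 0)"
        using gen by (simp add: generates_def)
      have "((\<lambda>h. S (t + h) g) \<longlongrightarrow> S t g) (at_left 0)"
      proof -
        have "at_left t = filtermap (\<lambda>h. t + h) (at_left 0)"
          using filtermap_at_left_shift[of "-t" 0] by (simp add: add.commute)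
        then show ?thesis using left_continuous[OF t, of g] by (simp add: filterlim_filtermap)
      qed
      then show "((\<lambda>h. S (t - h) g) \<longlongrightarrow> S t g) (at_right 0)"
        unfolding filterlim_at_left_to_right by simp
    qed
    then have "((\<lambda>h. k * norm ((S h f - f) /\<^sub>R h - g) + norm (S (t - h) g - S t g))
        \<longlongrightarrow> 0) (at_right 0)" by simp
    moreover have "\<forall>\<^sub>F h in at_right 0. h > 0 \<and> h < t - c"
      using k by (auto simp: eventually_at_right_field intro!: exI[of _ "t - c"])
    then have "\<forall>\<^sub>F h in at_right 0. norm ((S (t - h) f - S t f) /\<^sub>R (- h) - S t g)
        \<le> k * norm ((S h f - f) /\<^sub>R h - g) + norm (S (t - h) g - S t g)"
    proof eventually_elim
      case (elim h)
      interpret Sh: bounded_linear "S (t - h)" by (rule bounded_linear) (use elim k in simp)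
      have "S t f = S (t - h) (S h f)" using add[of "t - h" h f] elim k by simp
      then have "(S (t - h) f - S t f) /\<^sub>R (- h) - S t g
          = S (t - h) ((S h f - f) /\<^sub>R h - g) + (S (t - h) g - S t g)"
        by (simp add: Sh.diff Sh.add Sh.scaleR algebra_simps)
      also have "norm \<dots> \<le> norm (S (t - h) ((S h f - f) /\<^sub>R h - g)) + norm (S (t - h) g - S t g)"
        by (rule norm_triangle_ineq)
      also have "\<dots> \<le> k * norm ((S h f - f) /\<^sub>R h - g) + norm (S (t - h) g - S t g)"
        using k(5)[of "t - h" "(S h f - f) /\<^sub>R h - g"] elim k by simp
      finally show ?case .
    qed
    ultimately have "((\<lambda>h. (S (t - h) f - S t f) /\<^sub>R (- h) - S t g) \<longlongrightarrow> 0) (at_right 0)"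
      by (rule Lim_null_comparison[rotated])
    then show ?thesis by (simp add: LIM_zero_iff)
  qed
  then have left: "((\<lambda>h. (S (t + h) f - S t f) /\<^sub>R h) \<longlongrightarrow> S t g) (at_left 0)"
    unfolding filterlim_at_left_to_right by simp
  have "((\<lambda>h. (S (t + h) f - S t f) /\<^sub>R h) \<longlongrightarrow> S t g) (at 0)"
    by (rule filterlim_split_at[OF left right])
  then have "(\<lambda>h. norm ((S (t + h) f - S t f) /\<^sub>R h - S t g)) \<midarrow>0\<rightarrow> 0"
    by (simp add: tendsto_norm_zero_iff LIM_zero_iff)
  moreover have "\<forall>\<^sub>F h in at (0::real). norm ((S (t + h) f - S t f) /\<^sub>R h - S t g)
      = norm (S (t + h) f - S t f - h *\<^sub>R S t g) / norm h"
    unfolding eventually_at_filter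
  proof (intro always_eventually allI impI)
    fix h :: real assume h: "h \<noteq> 0"
    have "S (t + h) f - S t f - h *\<^sub>R S t g = h *\<^sub>R ((S (t + h) f - S t f) /\<^sub>R h - S t g)"
      using h by (simp add: scaleR_diff_right)
    then show "norm ((S (t + h) f - S t f) /\<^sub>R h - S t g)
        = norm (S (t + h) f - S t f - h *\<^sub>R S t g) / norm h"
      using h by simp
  qed
  ultimately have "(\<lambda>h. norm (S (t + h) f - S t f - h *\<^sub>R S t g) / norm h) \<midarrow>0\<rightarrow> 0"
    by (rule Lim_transform_eventually)
  then show ?thesis
    unfolding has_vector_derivative_def has_derivative_at
    by (intro conjI bounded_linear_scaleR_left)
qed

end

section \<open>The Laplacian and the Dirichlet form\<close>

abbreviation point :: "'a \<Rightarrow> 'a \<Rightarrow> real" where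
  "point a \<equiv> (\<lambda>x. if x = a then 1 else 0)"

context weighted_graph
begin

lemma weight_pos_iff: "b x y \<noteq> 0 \<longleftrightarrow> b x y > 0"
  using weight_nonneg[of x y] by auto

definition laplacian :: "('v \<Rightarrow> real) \<Rightarrow> 'v \<Rightarrow> real" where
  "laplacian f x = (\<Sum>y | b x y > 0. b x y * (f x - f y)) / m x"

definition embed :: "('v \<Rightarrow> real) \<Rightarrow> 'v l2" where
  "embed f = Abs_l2 (\<lambda>x. f x * sqrt (m x))"

definition unembed :: "'v l2 \<Rightarrow> 'v \<Rightarrow> real" where
  "unembed F x = l2_fun F x / sqrt (m x)"

text \<open>
  The form is half the inner product of these weighted differences (\<open>dform_eq\<close>).
\<close>
definition grad :: "('v \<Rightarrow> real) \<Rightarrow> ('v \<times> 'v) l2" where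
  "grad f = Abs_l2 (\<lambda>(x, y). sqrt (b x y) * (f x - f y))"

lemma ell2_iff: "f \<in> ell2 m \<longleftrightarrow> (\<lambda>x. (f x * sqrt (m x))\<^sup>2) summable_on UNIV"
  using measure_pos by (simp add: ell2_def power_mult_distrib less_imp_le)

lemma l2_fun_embed: "f \<in> ell2 m \<Longrightarrow> l2_fun (embed f) x = f x * sqrt (m x)"
  by (simp add: embed_def ell2_iff Abs_l2_inverse)

lemma finite_energy_iff:
  "finite_energy b f \<longleftrightarrow> (\<lambda>z. (case z of (x, y) \<Rightarrow> sqrt (b x y) * (f x - f y))\<^sup>2) summable_on UNIV"
proof -
  have "(\<lambda>z. (case z of (x, y) \<Rightarrow> sqrt (b x y) * (f x - f y))\<^sup>2)
      = (\<lambda>(x, y). b x y * (f x - f y)\<^sup>2)"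
    by (auto simp: power_mult_distrib weight_nonneg)
  then show ?thesis by (simp only: finite_energy_def)
qed

lemma l2_fun_grad:
  "finite_energy b f \<Longrightarrow> l2_fun (grad f) (x, y) = sqrt (b x y) * (f x - f y)"
  by (simp add: grad_def finite_energy_iff Abs_l2_inverse)

lemma sqrt_measure_pos: "sqrt (m x) > 0"
  using measure_pos by simp

lemma embed_unembed [simp]: "embed (unembed F) = F"
proof -
  have "sqrt (m x) \<noteq> 0" for x using sqrt_measure_pos[of x] by linarith
  then show ?thesis by (simp add: embed_def unembed_def l2_fun_inverse)
qed

lemma unembed_in_ell2 [simp]: "unembed F \<in> ell2 m"
proof -
  have "sqrt (m x) \<noteq> 0" for x using sqrt_measure_pos[of x] by linarith
  then show ?thesis using l2_fun[of F] by (simp add: ell2_iff unembed_def)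
qed

lemma unembed_embed [simp]: "f \<in> ell2 m \<Longrightarrow> unembed (embed f) = f"
proof -
  have "sqrt (m x) \<noteq> 0" for x using sqrt_measure_pos[of x] by linarith
  then show "f \<in> ell2 m \<Longrightarrow> ?thesis" by (auto simp: unembed_def l2_fun_embed)
qed

lemma unembed_lincomb:
  "unembed (\<alpha> *\<^sub>R F + \<beta> *\<^sub>R G) = (\<lambda>x. \<alpha> * unembed F x + \<beta> * unembed G x)"
  by (rule ext) (simp add: unembed_def plus_l2.rep_eq scaleR_l2.rep_eq add_divide_distrib)

lemma ell2_lincomb:
  assumes "f \<in> ell2 m" "g \<in> ell2 m"
  shows "(\<lambda>x. \<alpha> * f x + \<beta> * g x) \<in> ell2 m"
    and "embed (\<lambda>x. \<alpha> * f x + \<beta> * g x) = \<alpha> *\<^sub>R embed f + \<beta> *\<^sub>R embed g"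
proof -
  have "(\<lambda>x. \<alpha> * f x + \<beta> * g x) = unembed (\<alpha> *\<^sub>R embed f + \<beta> *\<^sub>R embed g)"
    using assms by (simp add: unembed_lincomb)
  then show "(\<lambda>x. \<alpha> * f x + \<beta> * g x) \<in> ell2 m"
    "embed (\<lambda>x. \<alpha> * f x + \<beta> * g x) = \<alpha> *\<^sub>R embed f + \<beta> *\<^sub>R embed g"
    by simp_all
qed

lemma ell2_diff:
  assumes "f \<in> ell2 m" "g \<in> ell2 m"
  shows "(\<lambda>x. f x - g x) \<in> ell2 m" and "embed (\<lambda>x. f x - g x) = embed f - embed g"
  using ell2_lincomb[OF assms, of 1 "-1"] by simp_all

lemma ell2_uminus:
  assumes "f \<in> ell2 m"
  shows "(\<lambda>x. - f x) \<in> ell2 m" and "embed (\<lambda>x. - f x) = - embed f"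
  using ell2_lincomb[OF assms assms, of "-1" 0] by simp_all

lemma ell2_inner_eq:
  assumes "f \<in> ell2 m" "g \<in> ell2 m"
  shows "ell2_inner m f g = inner (embed f) (embed g)"
proof -
  have "f x * g x * m x = l2_fun (embed f) x * l2_fun (embed g) x" for x
    using measure_pos[of x] assms
    by (simp add: l2_fun_embed mult_ac flip: real_sqrt_mult)
  then show ?thesis by (simp add: ell2_inner_def inner_l2.rep_eq)
qed

lemma ell2_norm_eq: "f \<in> ell2 m \<Longrightarrow> ell2_norm m f = norm (embed f)"
  by (simp add: ell2_norm_def ell2_inner_eq norm_eq_sqrt_inner)

lemma finite_energy_diff:
  assumes "finite_energy b f" "finite_energy b g"
  shows "finite_energy b (\<lambda>x. f x - g x)" and "grad (\<lambda>x. f x - g x) = grad f - grad g"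
proof -
  have eq: "l2_fun (grad f - grad g)
      = (\<lambda>(x, y). sqrt (b x y) * ((f x - g x) - (f y - g y)))"
    using assms by (auto simp: minus_l2.rep_eq l2_fun_grad algebra_simps)
  show "finite_energy b (\<lambda>x. f x - g x)"
    using l2_fun[of "grad f - grad g"] by (simp only: eq finite_energy_iff mem_Collect_eq)
  show "grad (\<lambda>x. f x - g x) = grad f - grad g"
    unfolding grad_def[of "\<lambda>x. f x - g x"] eq[symmetric] by (rule l2_fun_inverse)
qed

lemma dform_eq:
  assumes "finite_energy b f" "finite_energy b g"
  shows "dform b f g = inner (grad f) (grad g) / 2"
proof -
  have "(case z of (x, y) \<Rightarrow> b x y * (f x - f y) * (g x - g y))
      = l2_fun (grad f) z * l2_fun (grad g) z" for z
    using assms weight_nonneg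
    by (cases z) (simp add: l2_fun_grad algebra_simps flip: real_sqrt_mult)
  then have "(\<Sum>\<^sub>\<infinity>(x, y). b x y * (f x - f y) * (g x - g y)) = inner (grad f) (grad g)"
    unfolding inner_l2.rep_eq by (rule infsum_cong)
  then show ?thesis by (simp add: dform_def)
qed

definition neighbourhood :: "'v set \<Rightarrow> 'v set" where
  "neighbourhood S = S \<union> (\<Union>x\<in>S. {y. b x y > 0})"

lemma finite_neighbourhood: "finite S \<Longrightarrow> finite (neighbourhood S)"
  using locally_finite by (simp add: neighbourhood_def)

text \<open>
  Edges along which a finitely supported function varies stay within a finite set of vertices, so
  the sum that defines the form is finite if one argument has finite support.
\<close>
lemma finite_support_edges:
  assumes supp: "\<And>x. x \<notin> S \<Longrightarrow> f x = 0" and out: "x \<notin> neighbourhood S \<or> y \<notin> neighbourhood S"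
  shows "b x y = 0 \<or> f x = f y"
proof (rule ccontr)
  assume "\<not> ?thesis"
  then have nz: "b x y > 0" "f x \<noteq> f y" by (auto simp: weight_pos_iff)
  then have "b y x > 0" by (simp add: weight_sym[of y x])
  moreover have "x \<in> S \<or> y \<in> S" using supp nz(2) by metis
  moreover note nz(1)
  ultimately show False using out by (auto simp: neighbourhood_def)
qed

lemma dform_finite_support:
  assumes "finite S" and supp: "\<And>x. x \<notin> S \<Longrightarrow> f x = 0"
  shows "dform b f h
    = (\<Sum>x\<in>neighbourhood S. \<Sum>y\<in>neighbourhood S. b x y * (f x - f y) * (h x - h y)) / 2"
proof -
  let ?F = "neighbourhood S"
  have "(\<Sum>\<^sub>\<infinity>(x, y). b x y * (f x - f y) * (h x - h y))
      = (\<Sum>\<^sub>\<infinity>(x, y)\<in>?F \<times> ?F. b x y * (f x - f y) * (h x - h y))"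
    by (rule infsum_cong_neutral) (use finite_support_edges[OF supp] in fastforce)+
  also have "\<dots> = (\<Sum>(x, y)\<in>?F \<times> ?F. b x y * (f x - f y) * (h x - h y))"
    using finite_neighbourhood[OF assms(1)] by simp
  finally show ?thesis by (simp add: dform_def sum.cartesian_product)
qed

lemma symmetric_double_sum:
  "(\<Sum>x\<in>F. \<Sum>y\<in>F. b x y * (f x - f y) * (h x - h y)) / 2
    = (\<Sum>x\<in>F. (\<Sum>y\<in>F. b x y * (f x - f y)) * h x)"
proof -
  have "(\<Sum>x\<in>F. \<Sum>y\<in>F. b x y * (f x - f y) * h y)
      = (\<Sum>y\<in>F. \<Sum>x\<in>F. b x y * (f x - f y) * h y)" by (rule sum.swap)
  also have "\<dots> = (\<Sum>y\<in>F. \<Sum>x\<in>F. - (b y x * (f y - f x) * h y))"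
    by (intro sum.cong refl) (metis weight_sym minus_diff_eq mult_minus_left mult_minus_right)
  finally have "(\<Sum>x\<in>F. \<Sum>y\<in>F. b x y * (f x - f y) * h y)
      = - (\<Sum>x\<in>F. \<Sum>y\<in>F. b x y * (f x - f y) * h x)" by (simp only: sum_negf)
  then show ?thesis
    unfolding right_diff_distrib[of "b x y * (f x - f y)" for x y] sum_subtractf sum_distrib_right
    by simp
qed

lemma sum_neighbours:
  assumes "finite F" and "\<And>y. b x y > 0 \<Longrightarrow> y \<notin> F \<Longrightarrow> f x = f y"
  shows "(\<Sum>y\<in>F. b x y * (f x - f y)) = m x * laplacian f x"
proof -
  have "(\<Sum>y\<in>F. b x y * (f x - f y)) = (\<Sum>y | b x y > 0. b x y * (f x - f y))"
    by (rule sum.mono_neutral_cong) (use assms locally_finite weight_pos_iff in auto)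
  then show ?thesis using measure_pos[of x] by (simp add: laplacian_def)
qed

lemma laplacian_finite_support:
  assumes supp: "\<And>x. x \<notin> S \<Longrightarrow> f x = 0" and x: "x \<notin> neighbourhood S"
  shows "laplacian f x = 0"
proof -
  have "f y = 0" if "b x y > 0" for y
    using x supp that weight_sym[of x y] by (auto simp: neighbourhood_def)
  moreover have "f x = 0" using x supp by (auto simp: neighbourhood_def)
  ultimately show ?thesis by (simp add: laplacian_def)
qed

text \<open>
  Green's formula, twice: the finite support allows the summation by parts
  \<open>symmetric_double_sum\<close>, and the Laplacian may be put on either function. The version with the
  Laplacian on \<open>h\<close> identifies the operator pointwise; the one with the Laplacian on \<open>f\<close> shows that
  finitely supported functions belong to its domain.
\<close>
lemma green_right:
  assumes "finite S" and supp: "\<And>x. x \<notin> S \<Longrightarrow> f x = 0"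
  shows "dform b h f = (\<Sum>x\<in>S. m x * laplacian h x * f x)"
proof -
  let ?F = "neighbourhood S"
  have "dform b h f = dform b f h" by (simp add: dform_def mult_ac)
  also have "\<dots> = (\<Sum>x\<in>?F. \<Sum>y\<in>?F. b x y * (h x - h y) * (f x - f y)) / 2"
    using dform_finite_support[OF assms] by (simp add: mult_ac)
  also have "\<dots> = (\<Sum>x\<in>?F. (\<Sum>y\<in>?F. b x y * (h x - h y)) * f x)"
    by (rule symmetric_double_sum)
  also have "\<dots> = (\<Sum>x\<in>S. m x * laplacian h x * f x)"
  proof (rule sum.mono_neutral_cong)
    fix x assume "x \<in> ?F \<inter> S"
    then have "(\<Sum>y\<in>?F. b x y * (h x - h y)) = m x * laplacian h x"
      by (intro sum_neighbours finite_neighbourhood assms) (auto simp: neighbourhood_def)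
    then show "(\<Sum>y\<in>?F. b x y * (h x - h y)) * f x = m x * laplacian h x * f x" by simp
  qed (use assms finite_neighbourhood in \<open>auto simp: neighbourhood_def\<close>)
  finally show ?thesis .
qed

lemma green_left:
  assumes "finite S" and supp: "\<And>x. x \<notin> S \<Longrightarrow> f x = 0"
  shows "dform b f h = (\<Sum>x\<in>neighbourhood S. m x * laplacian f x * h x)"
proof -
  let ?F = "neighbourhood S"
  have "dform b f h = (\<Sum>x\<in>?F. (\<Sum>y\<in>?F. b x y * (f x - f y)) * h x)"
    using dform_finite_support[OF assms] symmetric_double_sum by simp
  also have "\<dots> = (\<Sum>x\<in>?F. m x * laplacian f x * h x)"
  proof (intro sum.cong refl)
    fix x assume "x \<in> ?F"
    have "f x = f y" if "b x y > 0" "y \<notin> ?F" for y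
    proof -
      have "x \<notin> S" "y \<notin> S" using that by (auto simp: neighbourhood_def)
      then show ?thesis using supp by simp
    qed
    then show "(\<Sum>y\<in>?F. b x y * (f x - f y)) * h x = m x * laplacian f x * h x"
      by (subst sum_neighbours) (use finite_neighbourhood assms in auto)
  qed
  finally show ?thesis .
qed

lemma finite_support_ell2:
  assumes "finite S" and supp: "\<And>x. x \<notin> S \<Longrightarrow> f x = 0"
  shows "f \<in> ell2 m" and "ell2_inner m f h = (\<Sum>x\<in>S. f x * h x * m x)"
proof -
  have "(\<lambda>x. (f x)\<^sup>2 * m x) summable_on UNIV \<longleftrightarrow> (\<lambda>x. (f x)\<^sup>2 * m x) summable_on S"
    by (rule summable_on_cong_neutral) (use supp in auto)
  then show "f \<in> ell2 m" using assms by (simp add: ell2_def)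
  have "(\<Sum>\<^sub>\<infinity>x. f x * h x * m x) = (\<Sum>\<^sub>\<infinity>x\<in>S. f x * h x * m x)"
    by (rule infsum_cong_neutral) (use supp in auto)
  then show "ell2_inner m f h = (\<Sum>x\<in>S. f x * h x * m x)" using assms by (simp add: ell2_inner_def)
qed

lemma finite_support_energy:
  assumes "finite S" and supp: "\<And>x. x \<notin> S \<Longrightarrow> f x = 0"
  shows "finite_energy b f"
proof -
  let ?F = "neighbourhood S"
  have "(\<lambda>(x, y). b x y * (f x - f y)\<^sup>2) summable_on UNIV
      \<longleftrightarrow> (\<lambda>(x, y). b x y * (f x - f y)\<^sup>2) summable_on ?F \<times> ?F"
    by (rule summable_on_cong_neutral) (use finite_support_edges[OF supp] in fastforce)+
  then show ?thesis using finite_neighbourhood[OF assms(1)] by (simp add: finite_energy_def)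
qed

lemma finite_support_dform_domain:
  assumes "finite S" and supp: "\<And>x. x \<notin> S \<Longrightarrow> f x = 0"
  shows "f \<in> dform_domain b m"
proof -
  have "finite {x. f x \<noteq> 0}" by (rule finite_subset[OF _ assms(1)]) (use supp in auto)
  then have "\<exists>\<phi>. finite {x. \<phi> x \<noteq> 0} \<and> ell2_inner m (\<lambda>x. f x - \<phi> x) (\<lambda>x. f x - \<phi> x)
      + dform b (\<lambda>x. f x - \<phi> x) (\<lambda>x. f x - \<phi> x) < \<epsilon>" if "\<epsilon> > 0" for \<epsilon> :: real
    using that by (intro exI[of _ f]) (simp add: ell2_inner_def dform_def case_prod_unfold)
  then show ?thesis
    using finite_support_ell2(1)[OF assms] finite_support_energy[OF assms]
    by (simp add: dform_domain_def)
qed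

lemma dform_domainD:
  assumes "f \<in> dform_domain b m"
  shows "f \<in> ell2 m" "finite_energy b f"
    "\<epsilon> > 0 \<Longrightarrow> \<exists>\<phi>. finite {x. \<phi> x \<noteq> 0}
      \<and> (norm (embed f - embed \<phi>))\<^sup>2 + (norm (grad f - grad \<phi>))\<^sup>2 / 2 < \<epsilon>"
proof -
  show f: "f \<in> ell2 m" "finite_energy b f" using assms by (auto simp: dform_domain_def)
  assume "\<epsilon> > 0"
  then obtain \<phi> where \<phi>: "finite {x. \<phi> x \<noteq> 0}" "ell2_inner m (\<lambda>x. f x - \<phi> x) (\<lambda>x. f x - \<phi> x)
      + dform b (\<lambda>x. f x - \<phi> x) (\<lambda>x. f x - \<phi> x) < \<epsilon>"
    using assms unfolding dform_domain_def by blast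
  have "\<phi> \<in> ell2 m" "finite_energy b \<phi>"
    using finite_support_ell2(1)[OF \<phi>(1)] finite_support_energy[OF \<phi>(1)] by auto
  then show "\<exists>\<phi>. finite {x. \<phi> x \<noteq> 0}
      \<and> (norm (embed f - embed \<phi>))\<^sup>2 + (norm (grad f - grad \<phi>))\<^sup>2 / 2 < \<epsilon>"
    using \<phi> f ell2_diff[of f \<phi>] finite_energy_diff[of f \<phi>]
    by (intro exI[of _ \<phi>]) (simp add: ell2_inner_eq dform_eq power2_norm_eq_inner)
qed

text \<open>
  Testing the defining identity with \<^term>\<open>point a\<close> shows that the operator can only act as the
  pointwise Laplacian.
\<close>
lemma lap_domainD:
  assumes "f \<in> lap_domain b m"
  shows "f \<in> dform_domain b m" "laplacian f \<in> ell2 m" "lap b m f = laplacian f"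
    "h \<in> dform_domain b m \<Longrightarrow> dform b f h = inner (embed (laplacian f)) (embed h)"
proof -
  show "f \<in> dform_domain b m" using assms by (simp add: lap_domain_def)
  have unique: "g = laplacian f"
    if g: "g \<in> ell2 m" "\<And>h. h \<in> dform_domain b m \<Longrightarrow> dform b f h = ell2_inner m g h" for g
  proof
    fix a :: 'v
    have "m a * laplacian f a = dform b f (point a)" by (subst green_right[of "{a}"]) auto
    also have "\<dots> = ell2_inner m g (point a)"
      by (intro g finite_support_dform_domain[of "{a}"]) auto
    also have "\<dots> = ell2_inner m (point a) g" by (simp add: ell2_inner_def mult.commute)
    also have "\<dots> = g a * m a" by (subst finite_support_ell2(2)[of "{a}"]) auto
    finally show "g a = laplacian f a" using measure_pos[of a] by simp
  qed
  obtain g where g: "g \<in> ell2 m" "\<And>h. h \<in> dform_domain b m \<Longrightarrow> dform b f h = ell2_inner m g h"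
    using assms unfolding lap_domain_def by blast
  then have *: "laplacian f \<in> ell2 m"
      "\<And>h. h \<in> dform_domain b m \<Longrightarrow> dform b f h = ell2_inner m (laplacian f) h"
    using unique by auto
  show "laplacian f \<in> ell2 m" by (rule *)
  show "lap b m f = laplacian f"
    unfolding lap_def
  proof (rule the_equality)
    show "laplacian f \<in> ell2 m \<and> (\<forall>h\<in>dform_domain b m. dform b f h = ell2_inner m (laplacian f) h)"
      using * by blast
    show "g = laplacian f"
      if "g \<in> ell2 m \<and> (\<forall>h\<in>dform_domain b m. dform b f h = ell2_inner m g h)" for g
      by (rule unique) (use that in blast)+
  qed
  show "h \<in> dform_domain b m \<Longrightarrow> dform b f h = inner (embed (laplacian f)) (embed h)"
    using * dform_domainD(1) by (simp add: ell2_inner_eq)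
qed

lemma finite_support_lap_domain:
  assumes "finite S" and supp: "\<And>x. x \<notin> S \<Longrightarrow> f x = 0"
  shows "f \<in> lap_domain b m"
proof -
  have fin: "finite (neighbourhood S)" "\<And>x. x \<notin> neighbourhood S \<Longrightarrow> laplacian f x = 0"
    using finite_neighbourhood[OF assms(1)] laplacian_finite_support[OF supp] by auto
  have "dform b f h = ell2_inner m (laplacian f) h" for h
    using green_left[OF assms, where h = h] finite_support_ell2(2)[OF fin] by (simp add: mult_ac)
  then show ?thesis
    using finite_support_ell2(1)[OF fin] finite_support_dform_domain[OF assms]
    by (auto simp: lap_domain_def)
qed

end

section \<open>The heat semigroup as a semigroup on l2\<close>

locale heat_flow = weighted_graph b m
  for b :: "'v \<Rightarrow> 'v \<Rightarrow> real" and m :: "'v \<Rightarrow> real" +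
  fixes T :: "real \<Rightarrow> ('v \<Rightarrow> real) \<Rightarrow> 'v \<Rightarrow> real"
  assumes heat_semigroup: "heat_semigroup b m T"
begin

definition S :: "real \<Rightarrow> 'v l2 \<Rightarrow> 'v l2" where
  "S t F = embed (T t (unembed F))"

lemmas C0_semigroup = heat_semigroup[unfolded heat_semigroup_def C0_semigroup_ell2_def, THEN conjunct1]
lemmas T_in_ell2 = C0_semigroup[THEN conjunct1, rule_format]
lemmas T_lincomb = C0_semigroup[THEN conjunct2, THEN conjunct1, rule_format]
lemmas T_bounded = C0_semigroup[THEN conjunct2, THEN conjunct2, THEN conjunct1, rule_format]

lemma S_embed: "f \<in> ell2 m \<Longrightarrow> S t (embed f) = embed (T t f)"
  by (simp add: S_def)

lemma S_lincomb:
  assumes "t \<ge> 0"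
  shows "S t (\<alpha> *\<^sub>R F + \<beta> *\<^sub>R G) = \<alpha> *\<^sub>R S t F + \<beta> *\<^sub>R S t G"
  using assms by (simp add: S_def unembed_lincomb T_lincomb ell2_lincomb T_in_ell2)

sublocale c0_semigroup S
proof (rule c0_semigroup.intro)
  note rest = C0_semigroup[THEN conjunct2, THEN conjunct2, THEN conjunct2]
  show "bounded_linear (S t)" if t: "t \<ge> 0" for t
  proof -
    obtain C where C: "\<And>f. f \<in> ell2 m \<Longrightarrow> ell2_norm m (T t f) \<le> C * ell2_norm m f"
      using T_bounded[OF t] by blast
    show ?thesis
    proof (rule bounded_linear_intro[of _ C])
      fix F G :: "'v l2" and r :: real
      show "S t (F + G) = S t F + S t G" using S_lincomb[OF t, of 1 F 1 G] by simp
      show "S t (r *\<^sub>R F) = r *\<^sub>R S t F" using S_lincomb[OF t, of r F 0 F] by simp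
      show "norm (S t F) \<le> norm F * C"
        using C[of "unembed F"] t by (simp add: S_def ell2_norm_eq T_in_ell2 mult.commute)
    qed
  qed
  show "S 0 F = F" for F using rest[THEN conjunct1] by (simp add: S_def)
  show "S (s + t) F = S s (S t F)" if "s \<ge> 0" "t \<ge> 0" for s t F
  proof -
    have "T (s + t) (unembed F) = T s (T t (unembed F))"
      using rest[THEN conjunct2, THEN conjunct1] that by simp
    then show ?thesis using that by (simp add: S_def T_in_ell2)
  qed
  show "((\<lambda>t. S t F) \<longlongrightarrow> F) (at_right 0)" for F
  proof -
    have "((\<lambda>t. ell2_norm m (\<lambda>x. T t (unembed F) x - unembed F x)) \<longlongrightarrow> 0) (at_right 0)"
      using rest[THEN conjunct2, THEN conjunct2] by simp
    moreover have "\<forall>\<^sub>F t in at_right 0.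
        ell2_norm m (\<lambda>x. T t (unembed F) x - unembed F x) = norm (S t F - F)"
      using eventually_at_right_less
      by eventually_elim (simp add: S_def ell2_norm_eq ell2_diff T_in_ell2)
    ultimately have "((\<lambda>t. norm (S t F - F)) \<longlongrightarrow> 0) (at_right 0)"
      by (rule Lim_transform_eventually)
    then show ?thesis by (simp add: tendsto_norm_zero_iff LIM_zero_iff)
  qed
qed

lemma generator_at_iff:
  assumes f: "f \<in> ell2 m" and g: "g \<in> ell2 m"
  shows "generator_at m T f g \<longleftrightarrow> generates (embed f) (embed g)"
proof -
  have "\<forall>\<^sub>F t in at_right 0. ell2_norm m (\<lambda>x. (T t f x - f x) / t - g x)
      = norm ((S t (embed f) - embed f) /\<^sub>R t - embed g)"
    using eventually_at_right_less
  proof eventually_elim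
    case (elim t)
    have Tf: "T t f \<in> ell2 m" using T_in_ell2 elim f by simp
    have quot: "(\<lambda>x. (T t f x - f x) / t) = (\<lambda>x. (1/t) * T t f x + (- 1/t) * f x)"
      by (auto simp: diff_divide_distrib)
    have "embed (\<lambda>x. (T t f x - f x) / t) = (1/t) *\<^sub>R embed (T t f) + (- 1/t) *\<^sub>R embed f"
      and mem: "(\<lambda>x. (T t f x - f x) / t) \<in> ell2 m"
      unfolding quot by (intro ell2_lincomb Tf f)+
    then have "embed (\<lambda>x. (T t f x - f x) / t) = (S t (embed f) - embed f) /\<^sub>R t"
      using f by (simp add: S_embed scaleR_diff_right divide_inverse)
    then show ?case using ell2_diff[OF mem g] by (simp add: ell2_norm_eq)
  qed
  then have "generator_at m T f g
      \<longleftrightarrow> ((\<lambda>t. norm ((S t (embed f) - embed f) /\<^sub>R t - embed g)) \<longlongrightarrow> 0) (at_right 0)"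
    unfolding generator_at_def by (rule filterlim_cong[OF refl refl])
  then show ?thesis by (simp add: generates_def tendsto_norm_zero_iff LIM_zero_iff)
qed

lemma generates_laplacian:
  assumes f: "f \<in> lap_domain b m"
  shows "generates (embed f) (- embed (laplacian f))"
proof -
  have "f \<in> ell2 m" "(\<lambda>x. - laplacian f x) \<in> ell2 m"
    using lap_domainD[OF f] dform_domainD(1) ell2_uminus by auto
  then have "generator_at m T f (\<lambda>x. - laplacian f x)"
    using heat_semigroup f lap_domainD(3)[OF f] by (simp add: heat_semigroup_def)
  then show ?thesis
    using generator_at_iff[of f "\<lambda>x. - laplacian f x"] lap_domainD[OF f] dform_domainD(1) ell2_uminus
    by simp
qed

text \<open>
  The semigroup preserves the domain of its generator and commutes with it; the generator is known
  to be minus the Laplacian with exactly the domain of the form operator.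
\<close>
lemma semigroup_laplacian:
  assumes f: "f \<in> lap_domain b m" and t: "t \<ge> 0"
  shows "T t f \<in> lap_domain b m" and "laplacian (T t f) = T t (laplacian f)"
proof -
  have ell2: "f \<in> ell2 m" "laplacian f \<in> ell2 m"
    using lap_domainD[OF f] dform_domainD(1) by auto
  interpret St: bounded_linear "S t" by (rule bounded_linear[OF t])
  let ?g = "\<lambda>x. - T t (laplacian f) x"
  have g: "?g \<in> ell2 m" "embed ?g = - embed (T t (laplacian f))"
    using ell2_uminus T_in_ell2[OF t ell2(2)] by auto
  have "generates (S t (embed f)) (S t (- embed (laplacian f)))"
    by (rule generates_shift[OF generates_laplacian[OF f] t])
  then have "generates (embed (T t f)) (embed ?g)"
    using ell2 g by (simp add: St.neg S_embed)
  then have "generator_at m T (T t f) ?g"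
    using generator_at_iff[OF T_in_ell2[OF t ell2(1)] g(1)] by simp
  then have *: "T t f \<in> lap_domain b m" "?g = (\<lambda>x. - lap b m (T t f) x)"
    using heat_semigroup T_in_ell2[OF t ell2(1)] g(1) unfolding heat_semigroup_def by blast+
  show "T t f \<in> lap_domain b m" by (rule *)
  show "laplacian (T t f) = T t (laplacian f)"
    using *(2) lap_domainD(3)[OF *(1)] by (auto simp: fun_eq_iff)
qed

lemma heat_equation:
  assumes f: "f \<in> lap_domain b m" and t: "t > 0"
  shows "((\<lambda>s. embed (T s f)) has_vector_derivative - embed (laplacian (T t f))) (at t)"
proof -
  have ell2: "f \<in> ell2 m" "laplacian f \<in> ell2 m"
    using lap_domainD[OF f] dform_domainD(1) by auto
  interpret St: bounded_linear "S t" by (rule bounded_linear) (use t in simp)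
  have "((\<lambda>s. S s (embed f)) has_vector_derivative S t (- embed (laplacian f))) (at t)"
    by (rule has_vector_derivative[OF generates_laplacian[OF f] t])
  then show ?thesis using ell2 semigroup_laplacian[OF f, of t] t by (simp add: St.neg S_embed)
qed

lemma continuous_on_embed_T: "f \<in> ell2 m \<Longrightarrow> continuous_on {0..} (\<lambda>t. embed (T t f))"
  using continuous_on[of "embed f"] by (simp add: S_embed)

end

section \<open>Dirichlet solutions on finite sets\<close>

text \<open>
  The minimum principle for finitely many functions of time. After adding \<open>\<epsilon> (1 + t)\<close> all of them
  start out positive. At the first time \<open>t\<^sub>0\<close> at which one of them vanishes it is the minimal one,
  so its derivative is at least \<open>\<epsilon> > 0\<close>, and it would have been negative shortly before.
\<close>

lemma first_touching:
  fixes D D' :: "'i \<Rightarrow> real \<Rightarrow> real"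
  assumes fin: "finite I"
    and cont: "\<And>i. i \<in> I \<Longrightarrow> continuous_on {0..} (D i)"
    and deriv: "\<And>i t. i \<in> I \<Longrightarrow> t > 0 \<Longrightarrow> (D i has_real_derivative D' i t) (at t)"
    and init: "\<And>i. i \<in> I \<Longrightarrow> D i 0 \<ge> 0"
    and step: "\<And>i t. i \<in> I \<Longrightarrow> t > 0 \<Longrightarrow> D i t < 0 \<Longrightarrow> (\<And>j. j \<in> I \<Longrightarrow> D i t \<le> D j t) \<Longrightarrow> D' i t \<ge> 0"
    and i: "i \<in> I" and t: "t \<ge> 0"
  shows "D i t \<ge> 0"
proof (rule ccontr)
  assume neg: "\<not> D i t \<ge> 0"
  define \<epsilon> where "\<epsilon> = - D i t / (2 * (1 + t))"
  have \<epsilon>: "\<epsilon> > 0" unfolding \<epsilon>_def using neg t by (intro divide_pos_pos) auto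
  define E where "E j s = D j s + \<epsilon> * (1 + s)" for j s
  have contE: "continuous_on {0..t} (E j)" if "j \<in> I" for j
    unfolding E_def by (intro continuous_intros continuous_on_subset[OF cont[OF that]]) auto
  define Z where "Z = (\<Union>j\<in>I. {0..t} \<inter> E j -` {..0})"
  have "closed Z" unfolding Z_def
    by (intro closed_UN fin ballI continuous_closed_preimage contE closed_atLeastAtMost closed_atMost)
  moreover have "E i t = D i t / 2" using t by (simp add: E_def \<epsilon>_def field_simps)
  then have "t \<in> Z" unfolding Z_def using neg t i by (auto intro!: bexI[of _ i])
  moreover have bdd: "bdd_below Z" unfolding Z_def bdd_below_def by (intro exI[of _ 0]) auto
  ultimately have "Inf Z \<in> Z" by (intro closed_contains_Inf) auto
  define t0 where "t0 = Inf Z"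
  obtain j where j: "j \<in> I" "E j t0 \<le> 0" and t0: "0 \<le> t0" "t0 \<le> t"
    using \<open>Inf Z \<in> Z\<close> unfolding t0_def[symmetric] by (auto simp: Z_def)
  have before: "E k s > 0" if "k \<in> I" "0 \<le> s" "s < t0" for k s
  proof (rule ccontr)
    assume "\<not> E k s > 0"
    then have "s \<in> Z" unfolding Z_def using that t0 by (auto intro!: bexI[of _ k])
    then have "t0 \<le> s" unfolding t0_def by (rule cInf_lower[OF _ bdd])
    then show False using that by simp
  qed
  have "E j 0 > 0" using init[OF j(1)] \<epsilon> by (simp add: E_def)
  then have t0_pos: "t0 > 0" using j t0 by (cases "t0 = 0") auto
  have derivE: "(E k has_real_derivative D' k t0 + \<epsilon>) (at t0)" if "k \<in> I" for k
    unfolding E_def by (rule derivative_eq_intros deriv that t0_pos refl)+ simp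
  have nonneg: "E k t0 \<ge> 0" if "k \<in> I" for k
  proof (rule tendsto_lowerbound)
    show "(E k \<longlongrightarrow> E k t0) (at_left t0)"
      using DERIV_isCont[OF derivE[OF that]] by (simp add: isCont_def filterlim_at_split)
    have "\<forall>\<^sub>F s in at_left t0. 0 < s \<and> s < t0"
      using t0_pos by (auto simp: eventually_at_left_field)
    then show "\<forall>\<^sub>F s in at_left t0. 0 \<le> E k s"
      by eventually_elim (use before[OF that] in \<open>simp add: less_imp_le\<close>)
  qed simp
  have zero: "E j t0 = 0" using j nonneg[OF j(1)] by simp
  have "D' j t0 \<ge> 0"
  proof (rule step[OF j(1) t0_pos])
    have "\<epsilon> * (1 + t0) > 0" using \<epsilon> t0_pos by simp
    then show "D j t0 < 0" using zero by (simp add: E_def)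
    show "D j t0 \<le> D k t0" if "k \<in> I" for k
      using zero nonneg[OF that] by (simp add: E_def)
  qed
  then obtain d where d: "d > 0" "\<And>h. h > 0 \<Longrightarrow> h < d \<Longrightarrow> E j (t0 - h) < E j t0"
    using DERIV_pos_inc_left[OF derivE[OF j(1)]] \<epsilon> by auto
  have "E j (t0 - min (d/2) (t0/2)) < 0" using d t0_pos zero by simp
  moreover have "E j (t0 - min (d/2) (t0/2)) > 0"
    by (rule before[OF j(1)]) (use d t0_pos in auto)
  ultimately show False by simp
qed

context weighted_graph
begin

text \<open>
  For \<open>f\<close> supported in \<open>K\<close>, this is the operator \<open>f \<mapsto> 1\<^sub>K \<Delta> f\<close> of the Galerkin approximation on the
  space of functions supported in \<open>K\<close>.
\<close>
definition dirichlet_laplacian :: "'v set \<Rightarrow> ('v \<Rightarrow> real) \<Rightarrow> 'v \<Rightarrow> real" where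
  "dirichlet_laplacian K f x = (if x \<in> K then laplacian f x else 0)"

definition dirichlet_solution :: "'v set \<Rightarrow> (real \<Rightarrow> 'v \<Rightarrow> real) \<Rightarrow> bool" where
  "dirichlet_solution K w \<longleftrightarrow> (\<forall>t x. x \<notin> K \<longrightarrow> w t x = 0) \<and>
    (\<forall>t x. ((\<lambda>s. w s x) has_real_derivative - dirichlet_laplacian K (w t) x) (at t))"

lemma laplacian_sums:
  assumes "\<And>y. (\<lambda>n. c n * a n y) sums g y"
  shows "(\<lambda>n. c n * laplacian (a n) x) sums laplacian g x"
proof -
  have "(\<lambda>n. (\<Sum>y | b x y > 0. b x y * (c n * a n x - c n * a n y)) / m x) sums
      ((\<Sum>y | b x y > 0. b x y * (g x - g y)) / m x)"
    by (intro sums_divide sums_sum sums_mult sums_diff assms)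
  then show ?thesis
    by (simp add: laplacian_def sum_distrib_left algebra_simps)
qed

lemma laplacian_bound:
  assumes "\<And>y. \<bar>g y\<bar> \<le> B"
  shows "\<bar>laplacian g x\<bar> \<le> 2 * (\<Sum>y | b x y > 0. b x y) / m x * B"
proof -
  have "\<bar>\<Sum>y | b x y > 0. b x y * (g x - g y)\<bar> \<le> (\<Sum>y | b x y > 0. \<bar>b x y * (g x - g y)\<bar>)"
    by (rule sum_abs)
  also have "\<dots> \<le> (\<Sum>y | b x y > 0. b x y * (2 * B))"
  proof (rule sum_mono)
    fix y
    have "\<bar>g x - g y\<bar> \<le> 2 * B" using assms[of x] assms[of y] by linarith
    then show "\<bar>b x y * (g x - g y)\<bar> \<le> b x y * (2 * B)"
      by (simp add: abs_mult weight_nonneg mult_left_mono)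
  qed
  finally have "\<bar>\<Sum>y | b x y > 0. b x y * (g x - g y)\<bar> / m x
      \<le> (\<Sum>y | b x y > 0. b x y * (2 * B)) / m x"
    using measure_pos[of x] by (intro divide_right_mono) auto
  also have "\<dots> = 2 * (\<Sum>y | b x y > 0. b x y) / m x * B"
    by (simp add: sum_distrib_right[symmetric])
  finally show ?thesis using measure_pos[of x] by (simp add: laplacian_def)
qed

text \<open>
  The solution is the exponential series of the bounded operator \<^term>\<open>\<lambda>g x. - dirichlet_laplacian K g x\<close>,
  summed at each vertex.
\<close>
lemma dirichlet_solution_exists:
  assumes K: "finite K" and supp: "\<And>x. x \<notin> K \<Longrightarrow> f x = 0"
  obtains w where "dirichlet_solution K w" "w 0 = f"
proof -
  define A where "A n = ((\<lambda>g x. - dirichlet_laplacian K g x) ^^ n) f" for n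
  define w where "w t x = (\<Sum>n. (A n x / fact n) * t ^ n)" for t x
  have A0: "A 0 = f" and ASuc: "A (Suc n) = (\<lambda>x. - dirichlet_laplacian K (A n) x)" for n
    by (simp_all add: A_def)
  have A_supp: "A n x = 0" if "x \<notin> K" for n x
    using supp that by (cases n) (simp_all add: A0 ASuc dirichlet_laplacian_def)
  (* C bounds the operator in the supremum norm, M bounds the initial value *)
  define C where "C = (\<Sum>x\<in>K. 2 * (\<Sum>y | b x y > 0. b x y) / m x)"
  define M where "M = (\<Sum>x\<in>K. \<bar>f x\<bar>)"
  have deg: "2 * (\<Sum>y | b x y > 0. b x y) / m x \<ge> 0" for x
    using measure_pos[of x] by (intro divide_nonneg_pos mult_nonneg_nonneg sum_nonneg) (auto simp: weight_nonneg)
  have bound: "\<bar>A n x\<bar> \<le> M * C ^ n" for n x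
  proof (induction n arbitrary: x)
    case 0
    have "\<bar>f x\<bar> \<le> M"
    proof (cases "x \<in> K")
      case True then show ?thesis unfolding M_def using K by (intro member_le_sum) auto
    qed (simp add: supp M_def sum_nonneg)
    then show ?case by (simp add: A0)
  next
    case (Suc n)
    have nn: "M * C ^ n \<ge> 0" using Suc[of undefined] by linarith
    show ?case
    proof (cases "x \<in> K")
      case True
      have "\<bar>laplacian (A n) x\<bar> \<le> 2 * (\<Sum>y | b x y > 0. b x y) / m x * (M * C ^ n)"
        by (rule laplacian_bound) (rule Suc)
      also have "\<dots> \<le> C * (M * C ^ n)"
        unfolding C_def
        by (rule mult_right_mono[OF member_le_sum]) (use True K deg nn C_def in auto)
      finally show ?thesis using True by (simp add: ASuc dirichlet_laplacian_def mult_ac)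
    next
      case False
      have "C \<ge> 0" unfolding C_def by (intro sum_nonneg deg)
      then show ?thesis using False nn by (simp add: A_supp mult.left_commute)
    qed
  qed
  have summable: "summable (\<lambda>n. (A n x / fact n) * t ^ n)" for t x
  proof (rule summable_comparison_test)
    show "\<exists>N. \<forall>n\<ge>N. norm ((A n x / fact n) * t ^ n) \<le> M * (inverse (fact n) * (C * \<bar>t\<bar>) ^ n)"
    proof (intro exI allI impI)
      fix n
      have "\<bar>A n x\<bar> * \<bar>t\<bar> ^ n \<le> M * C ^ n * \<bar>t\<bar> ^ n"
        by (rule mult_right_mono[OF bound]) simp
      then show "norm ((A n x / fact n) * t ^ n) \<le> M * (inverse (fact n) * (C * \<bar>t\<bar>) ^ n)"
        by (simp add: abs_mult power_abs power_mult_distrib field_simps)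
    qed
    show "summable (\<lambda>n. M * (inverse (fact n) * (C * \<bar>t\<bar>) ^ n))"
      by (intro summable_mult summable_exp)
  qed
  have sums: "(\<lambda>n. (t ^ n / fact n) * A n x) sums w t x" for t x
    using summable_sums[OF summable[of x t]] by (simp add: w_def mult_ac)
  have shifted: "(\<lambda>n. diffs (\<lambda>n. A n x / fact n) n * t ^ n) sums (- dirichlet_laplacian K (w t) x)" for t x
  proof -
    have coeff: "diffs (\<lambda>n. A n x / fact n) n * t ^ n
        = - ((t ^ n / fact n) * dirichlet_laplacian K (A n) x)" for n
    proof -
      have "diffs (\<lambda>n. A n x / fact n) n = - (dirichlet_laplacian K (A n) x / fact n)"
        by (simp add: diffs_def ASuc fact_Suc del: of_nat_Suc)
      then show ?thesis by simp
    qed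
    have "(\<lambda>n. (t ^ n / fact n) * dirichlet_laplacian K (A n) x) sums dirichlet_laplacian K (w t) x"
      using laplacian_sums[OF sums] by (simp add: dirichlet_laplacian_def)
    then show ?thesis unfolding coeff by (rule sums_minus)
  qed
  have "((\<lambda>s. w s x) has_real_derivative - dirichlet_laplacian K (w t) x) (at t)" for t x
    using termdiffs_strong_converges_everywhere[OF summable[of x], of t]
    unfolding sums_unique[OF shifted, symmetric] by (simp add: w_def)
  moreover have "w t x = 0" if "x \<notin> K" for t x using that by (simp add: w_def A_supp)
  ultimately have "dirichlet_solution K w" by (simp add: dirichlet_solution_def)
  moreover have "w 0 = f" by (rule ext) (simp only: w_def powser_zero, simp add: A0)
  ultimately show thesis by (rule that)
qed

text \<open>
  Since the equation is linear with constant coefficients, the time derivative of a solution is a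
  solution. The decay of the norm then bounds the time derivative by its initial value.
\<close>
lemma dirichlet_solution_derivative:
  assumes w: "dirichlet_solution K w"
  shows "dirichlet_solution K (\<lambda>t x. - dirichlet_laplacian K (w t) x)" (is "dirichlet_solution K ?z")
proof -
  have d: "((\<lambda>s. w s y) has_real_derivative ?z t y) (at t)" for t y
    using w by (simp add: dirichlet_solution_def)
  have "((\<lambda>s. ?z s x) has_real_derivative - dirichlet_laplacian K (?z t) x) (at t)" for t x
  proof (cases "x \<in> K")
    case True
    have "((\<lambda>s. - ((\<Sum>y | b x y > 0. b x y * (w s x - w s y)) / m x)) has_real_derivative
        - ((\<Sum>y | b x y > 0. b x y * (?z t x - ?z t y)) / m x)) (at t)"
      by (intro DERIV_minus DERIV_cdivide DERIV_sum DERIV_cmult DERIV_diff d)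
    then show ?thesis using True by (simp add: dirichlet_laplacian_def laplacian_def)
  next
    case False then show ?thesis by (simp add: dirichlet_laplacian_def)
  qed
  then show ?thesis by (simp add: dirichlet_solution_def dirichlet_laplacian_def)
qed

lemma laplacian_nonpos:
  assumes "\<And>y. b x y > 0 \<Longrightarrow> u y \<ge> u x"
  shows "laplacian u x \<le> 0"
  unfolding laplacian_def using assms measure_pos[of x]
  by (intro divide_nonpos_pos sum_nonpos mult_nonneg_nonpos weight_nonneg) auto

text \<open>
  At a negative minimum over \<open>K\<close> the value is also below the boundary value \<open>0\<close>, so the Laplacian is
  nonpositive there.
\<close>
lemma dirichlet_solution_nonneg:
  assumes K: "finite K" and w: "dirichlet_solution K w" and init: "\<And>x. w 0 x \<ge> 0" and t: "t \<ge> 0"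
  shows "w t x \<ge> 0"
proof (cases "x \<in> K")
  case True
  have d: "((\<lambda>s. w s y) has_real_derivative - dirichlet_laplacian K (w t) y) (at t)" for t y
    using w by (simp add: dirichlet_solution_def)
  show ?thesis
  proof (rule first_touching[where D = "\<lambda>x s. w s x" and D' = "\<lambda>x s. - dirichlet_laplacian K (w s) x"])
    show "continuous_on {0..} (\<lambda>s. w s y)" for y
      by (rule DERIV_continuous_on) (rule DERIV_subset[OF d], simp)
    fix y s assume y: "y \<in> K" "w s y < 0" "\<And>j. j \<in> K \<Longrightarrow> w s y \<le> w s j"
    have "w s y \<le> w s j" for j
      using y w by (cases "j \<in> K") (auto simp: dirichlet_solution_def)
    then have "laplacian (w s) y \<le> 0" by (rule laplacian_nonpos)
    then show "0 \<le> - dirichlet_laplacian K (w s) y"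
      using y(1) by (simp add: dirichlet_laplacian_def)
  qed (use K True t init d in auto)
next
  case False then show ?thesis using w by (simp add: dirichlet_solution_def)
qed

lemma point_in_ell2: "point a \<in> ell2 m"
  by (rule finite_support_ell2(1)[of "{a}"]) auto

text \<open>
  Writing a finitely supported function as a finite combination of point masses reduces
  differentiability in norm to differentiability at each vertex.
\<close>
lemma embed_finite_support:
  assumes "finite K" and supp: "\<And>x. x \<notin> K \<Longrightarrow> f x = 0"
  shows "embed f = (\<Sum>x\<in>K. f x *\<^sub>R embed (point x))"
proof -
  have "l2_fun (\<Sum>x\<in>K. f x *\<^sub>R embed (point x)) z = f z * sqrt (m z)" for z
  proof -
    interpret bounded_linear "\<lambda>F. l2_fun F z" by (rule bounded_linear_l2_fun)
    have "l2_fun (\<Sum>x\<in>K. f x *\<^sub>R embed (point x)) z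
        = (\<Sum>x\<in>K. if x = z then f x * sqrt (m z) else 0)"
      unfolding sum by (intro sum.cong refl) (auto simp: scaleR l2_fun_embed point_in_ell2)
    also have "\<dots> = f z * sqrt (m z)" using assms by simp
    finally show ?thesis .
  qed
  then show ?thesis
    using finite_support_ell2(1)[OF assms] by (simp add: l2_fun_inject[symmetric] fun_eq_iff l2_fun_embed)
qed

lemma dirichlet_solution_has_vector_derivative:
  assumes K: "finite K" and w: "dirichlet_solution K w"
  shows "((\<lambda>s. embed (w s)) has_vector_derivative
    embed (\<lambda>x. - dirichlet_laplacian K (w t) x)) (at t)"
proof -
  let ?e = "\<lambda>x. embed (point x)"
  have d: "((\<lambda>s. w s y) has_real_derivative - dirichlet_laplacian K (w t) y) (at t)" for t y
    using w by (simp add: dirichlet_solution_def)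
  have "((\<lambda>s. \<Sum>x\<in>K. w s x *\<^sub>R ?e x) has_vector_derivative
      (\<Sum>x\<in>K. (- dirichlet_laplacian K (w t) x) *\<^sub>R ?e x)) (at t)"
    by (intro has_vector_derivative_sum d[unfolded has_real_derivative_iff_has_vector_derivative]
        bounded_linear.has_vector_derivative[OF bounded_linear_scaleR_left])
  moreover have "(\<Sum>x\<in>K. w s x *\<^sub>R ?e x) = embed (w s)" for s
    by (rule embed_finite_support[symmetric, OF K]) (use w in \<open>auto simp: dirichlet_solution_def\<close>)
  moreover have "(\<Sum>x\<in>K. (- dirichlet_laplacian K (w t) x) *\<^sub>R ?e x)
      = embed (\<lambda>x. - dirichlet_laplacian K (w t) x)"
    by (rule embed_finite_support[symmetric, OF K]) (simp add: dirichlet_laplacian_def)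
  ultimately show ?thesis by simp
qed

lemma inner_dirichlet_laplacian:
  assumes K: "finite K" and w: "\<And>x. x \<notin> K \<Longrightarrow> f x = 0" and g: "\<And>x. x \<notin> K \<Longrightarrow> g x = 0"
  shows "inner (embed (\<lambda>x. - dirichlet_laplacian K f x)) (embed g) = - inner (grad f) (grad g) / 2"
proof -
  have supp: "\<And>x. x \<notin> K \<Longrightarrow> - dirichlet_laplacian K f x = 0"
    by (simp add: dirichlet_laplacian_def)
  have "inner (embed (\<lambda>x. - dirichlet_laplacian K f x)) (embed g)
      = ell2_inner m (\<lambda>x. - dirichlet_laplacian K f x) g"
    by (rule ell2_inner_eq[symmetric]) (intro finite_support_ell2(1)[OF K] supp g; assumption)+
  also have "\<dots> = (\<Sum>x\<in>K. - dirichlet_laplacian K f x * g x * m x)"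
    by (rule finite_support_ell2(2)[OF K supp])
  also have "\<dots> = - (\<Sum>x\<in>K. m x * laplacian f x * g x)"
    by (simp add: dirichlet_laplacian_def mult_ac sum_negf)
  also have "\<dots> = - dform b f g" using green_right[OF K g] by simp
  also have "\<dots> = - inner (grad f) (grad g) / 2"
    using dform_eq[OF finite_support_energy[OF K w] finite_support_energy[OF K g]] by simp
  finally show ?thesis .
qed

lemma dirichlet_solution_norm_decreasing:
  assumes K: "finite K" and w: "dirichlet_solution K w" and "s \<le> t"
  shows "norm (embed (w t)) \<le> norm (embed (w s))"
proof -
  have "inner (embed (w t)) (embed (w t)) \<le> inner (embed (w s)) (embed (w s))"
  proof (rule DERIV_nonpos_imp_nonincreasing[OF \<open>s \<le> t\<close>])
    fix r
    let ?z = "\<lambda>x. - dirichlet_laplacian K (w r) x"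
    have supp: "\<And>x. x \<notin> K \<Longrightarrow> w r x = 0" using w by (simp add: dirichlet_solution_def)
    have "((\<lambda>r. inner (embed (w r)) (embed (w r))) has_vector_derivative
        inner (embed (w r)) (embed ?z) + inner (embed ?z) (embed (w r))) (at r)"
      by (intro bounded_bilinear.has_vector_derivative[OF bounded_bilinear_inner]
          dirichlet_solution_has_vector_derivative K w)
    moreover have "inner (embed ?z) (embed (w r)) = - inner (grad (w r)) (grad (w r)) / 2"
      by (rule inner_dirichlet_laplacian[OF K supp supp])
    ultimately show "\<exists>y. ((\<lambda>r. inner (embed (w r)) (embed (w r))) has_real_derivative y) (at r) \<and> y \<le> 0"
      unfolding has_real_derivative_iff_has_vector_derivative
      by (intro exI conjI) (assumption, simp add: inner_commute)
  qed
  then show ?thesis by (simp add: norm_eq_sqrt_inner)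
qed

end

section \<open>Approximation by Dirichlet solutions on finite sets\<close>

context heat_flow
begin

lemma T_zero: "f \<in> ell2 m \<Longrightarrow> T 0 f = f"
  using C0_semigroup[THEN conjunct2, THEN conjunct2, THEN conjunct2, THEN conjunct1] by simp

text \<open>
  By Green's formula the energy of \<open>T s f - T t f\<close> is the inner product of \<open>T s f - T t f\<close> with its
  Laplacian \<open>T s (\<Delta> f) - T t (\<Delta> f)\<close>, and both tend to zero.
\<close>
lemma continuous_on_grad:
  assumes f: "f \<in> lap_domain b m"
  shows "continuous_on {0..} (\<lambda>t. grad (T t f))"
  unfolding continuous_on_def
proof
  fix t :: real assume t: "t \<in> {0..}"
  have ell2: "f \<in> ell2 m" "laplacian f \<in> ell2 m"
    using lap_domainD[OF f] dform_domainD(1) by auto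
  let ?U = "\<lambda>s. embed (T s f)" and ?V = "\<lambda>s. embed (T s (laplacian f))"
  have dom: "T s f \<in> dform_domain b m" "finite_energy b (T s f)" if "s \<ge> 0" for s
    using lap_domainD(1)[OF semigroup_laplacian(1)[OF f that]] dform_domainD(2) by auto
  have green: "inner (grad (T s f)) (grad (T r f)) = 2 * inner (?V s) (?U r)" if "s \<ge> 0" "r \<ge> 0" for s r
    using lap_domainD(4)[OF semigroup_laplacian(1)[OF f that(1)] dom(1)[OF that(2)]]
      dform_eq[OF dom(2)[OF that(1)] dom(2)[OF that(2)]] semigroup_laplacian(2)[OF f that(1)]
    by simp
  have "((\<lambda>s. 2 * inner (?V s - ?V t) (?U s - ?U t)) \<longlongrightarrow> 2 * inner (?V t - ?V t) (?U t - ?U t)) (at t within {0..})"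
    by (intro tendsto_intros; use continuous_on_embed_T[OF ell2(1)] continuous_on_embed_T[OF ell2(2)] t in
        \<open>simp add: continuous_on_def\<close>)
  then have "((\<lambda>s. sqrt (2 * inner (?V s - ?V t) (?U s - ?U t))) \<longlongrightarrow> sqrt 0) (at t within {0..})"
    by (intro tendsto_real_sqrt) simp
  moreover have "\<forall>\<^sub>F s in at t within {0..}.
      sqrt (2 * inner (?V s - ?V t) (?U s - ?U t)) = norm (grad (T s f) - grad (T t f))"
    unfolding eventually_at_filter
  proof (intro always_eventually allI impI)
    fix s :: real assume "s \<in> {0..}"
    then have "inner (grad (T s f) - grad (T t f)) (grad (T s f) - grad (T t f))
        = 2 * inner (?V s - ?V t) (?U s - ?U t)"
      using t by (simp add: inner_diff_left inner_diff_right green algebra_simps)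
    then show "sqrt (2 * inner (?V s - ?V t) (?U s - ?U t)) = norm (grad (T s f) - grad (T t f))"
      by (simp add: norm_eq_sqrt_inner)
  qed
  ultimately have "((\<lambda>s. norm (grad (T s f) - grad (T t f))) \<longlongrightarrow> sqrt 0) (at t within {0..})"
    by (rule Lim_transform_eventually)
  then show "((\<lambda>s. grad (T s f)) \<longlongrightarrow> grad (T t f)) (at t within {0..})"
    by (simp add: tendsto_norm_zero_iff LIM_zero_iff)
qed

text \<open>
  The curve \<open>s \<mapsto> T s f\<close> on \<open>[0, t]\<close> is compact in the form norm, hence finitely many approximations
  serve all times, and the union of their supports is finite.
\<close>
lemma uniform_finite_approximation:
  assumes f: "f \<in> lap_domain b m" and \<delta>: "\<delta> > 0"
  obtains K where "finite K"
    "\<And>s. 0 \<le> s \<Longrightarrow> s \<le> t \<Longrightarrow> \<exists>\<phi>. (\<forall>x. x \<notin> K \<longrightarrow> \<phi> x = 0)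
      \<and> norm (embed (T s f) - embed \<phi>) < \<delta> \<and> norm (grad (T s f) - grad \<phi>) < \<delta>"
proof -
  have ell2: "f \<in> ell2 m" using lap_domainD(1)[OF f] dform_domainD(1) by auto
  define G where "G s = (embed (T s f), grad (T s f))" for s
  have "continuous_on {0..t} G"
    unfolding G_def
    by (intro continuous_on_Pair continuous_on_subset[OF continuous_on_embed_T[OF ell2]]
        continuous_on_subset[OF continuous_on_grad[OF f]]) auto
  then have "compact (G ` {0..t})" by (rule compact_continuous_image) simp
  then obtain k where k: "finite k" "k \<subseteq> G ` {0..t}" "G ` {0..t} \<subseteq> (\<Union>g\<in>k. ball g (\<delta>/2))"
    using compact_imp_seq_compact seq_compact_imp_totally_bounded \<delta> half_gt_zero by metis
  have "\<exists>\<phi>. finite {x. \<phi> x \<noteq> 0} \<and> norm (fst g - embed \<phi>) < \<delta>/2 \<and> norm (snd g - grad \<phi>) < \<delta>/2"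
    if "g \<in> k" for g
  proof -
    obtain s where s: "s \<in> {0..t}" "g = G s" using \<open>g \<in> k\<close> k(2) by blast
    have "T s f \<in> dform_domain b m"
      using lap_domainD(1)[OF semigroup_laplacian(1)[OF f]] s by simp
    moreover have "(\<delta>/2)\<^sup>2 / 2 > 0" using \<delta> by simp
    ultimately obtain \<phi> where \<phi>: "finite {x. \<phi> x \<noteq> 0}"
      "(norm (embed (T s f) - embed \<phi>))\<^sup>2 + (norm (grad (T s f) - grad \<phi>))\<^sup>2 / 2 < (\<delta>/2)\<^sup>2 / 2"
      using dform_domainD(3) by blast
    have "0 \<le> (norm (embed (T s f) - embed \<phi>))\<^sup>2" "0 \<le> (norm (grad (T s f) - grad \<phi>))\<^sup>2" by simp_all
    then have sq: "(norm (embed (T s f) - embed \<phi>))\<^sup>2 < (\<delta>/2)\<^sup>2" "(norm (grad (T s f) - grad \<phi>))\<^sup>2 < (\<delta>/2)\<^sup>2"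
      using \<phi>(2) by linarith+
    have "\<delta>/2 \<ge> 0" using \<delta> by simp
    note power_less_imp_less_base[OF sq(1) this] power_less_imp_less_base[OF sq(2) this]
    then show ?thesis using \<phi>(1) s by (auto simp: G_def)
  qed
  then obtain \<Phi> where \<Phi>: "\<And>g. g \<in> k \<Longrightarrow> finite {x. \<Phi> g x \<noteq> 0}"
    "\<And>g. g \<in> k \<Longrightarrow> norm (fst g - embed (\<Phi> g)) < \<delta>/2" "\<And>g. g \<in> k \<Longrightarrow> norm (snd g - grad (\<Phi> g)) < \<delta>/2"
    by metis
  show thesis
  proof (rule that[of "\<Union>g\<in>k. {x. \<Phi> g x \<noteq> 0}"])
    show "finite (\<Union>g\<in>k. {x. \<Phi> g x \<noteq> 0})" using k(1) \<Phi>(1) by blast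
    fix s assume "0 \<le> s" "s \<le> t"
    then obtain g where g: "g \<in> k" "dist g (G s) < \<delta>/2" using k(3) by force
    have "dist (fst g) (fst (G s)) < \<delta>/2" "dist (snd g) (snd (G s)) < \<delta>/2"
      using g(2) dist_fst_le[of g "G s"] dist_snd_le[of g "G s"] by linarith+
    then have near: "norm (embed (T s f) - fst g) < \<delta>/2" "norm (grad (T s f) - snd g) < \<delta>/2"
      by (simp_all add: G_def dist_norm norm_minus_commute)
    have "norm (embed (T s f) - embed (\<Phi> g)) < \<delta> \<and> norm (grad (T s f) - grad (\<Phi> g)) < \<delta>"
      using norm_diff_triangle_less[OF near(1) \<Phi>(2)[OF g(1)]]
        norm_diff_triangle_less[OF near(2) \<Phi>(3)[OF g(1)]] by simp
    then show "\<exists>\<phi>. (\<forall>x. x \<notin> (\<Union>g\<in>k. {x. \<Phi> g x \<noteq> 0}) \<longrightarrow> \<phi> x = 0)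
      \<and> norm (embed (T s f) - embed \<phi>) < \<delta> \<and> norm (grad (T s f) - grad \<phi>) < \<delta>"
      using g(1) by (intro exI[of _ "\<Phi> g"]) auto
  qed
qed

text \<open>
  For \<open>u = T s f\<close>, the error \<open>e = u - w\<close> and its time derivative \<open>e'\<close> satisfy \<open>\<langle>e', \<psi>\<rangle> = - Q(e, \<psi>)\<close>
  for all \<open>\<psi>\<close> supported in \<open>K\<close>. Taking \<open>\<psi> = \<phi> - w\<close>, that is, \<open>e\<close> up to \<open>u - \<phi>\<close>, gives
  \<open>\<langle>e, e'\<rangle> = \<langle>u - \<phi>, e'\<rangle> - Q(e, e) + Q(e, u - \<phi>)\<close>, and the last two terms are at most
  \<open>Q(u - \<phi>, u - \<phi>) / 4\<close> by completing the square.
\<close>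
lemma galerkin_energy:
  assumes f: "f \<in> lap_domain b m" and s: "s \<ge> 0"
    and K: "finite K" and w: "\<And>x. x \<notin> K \<Longrightarrow> w x = 0" and \<phi>: "\<And>x. x \<notin> K \<Longrightarrow> \<phi> x = 0"
  defines "u \<equiv> T s f"
  defines "e' \<equiv> - embed (laplacian u) - embed (\<lambda>x. - dirichlet_laplacian K w x)"
  shows "inner (embed u - embed w) e'
    \<le> norm (embed u - embed \<phi>) * norm e' + (norm (grad u - grad \<phi>))\<^sup>2 / 8"
proof -
  let ?\<psi> = "\<lambda>x. \<phi> x - w x"
  have u: "u \<in> lap_domain b m" unfolding u_def by (rule semigroup_laplacian(1)[OF f s])
  have energy: "finite_energy b u" "finite_energy b \<phi>" "finite_energy b w"
    using dform_domainD(2)[OF lap_domainD(1)[OF u]] finite_support_energy[OF K \<phi>]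
      finite_support_energy[OF K w] by auto
  have ell2: "\<phi> \<in> ell2 m" "w \<in> ell2 m"
    using finite_support_ell2(1)[OF K \<phi>] finite_support_ell2(1)[OF K w] by auto
  have \<psi>: "\<And>x. x \<notin> K \<Longrightarrow> ?\<psi> x = 0" using w \<phi> by simp
  have "inner (embed (laplacian u)) (embed ?\<psi>) = inner (grad u) (grad ?\<psi>) / 2"
    using lap_domainD(4)[OF u finite_support_dform_domain[OF K \<psi>]]
      dform_eq[OF energy(1) finite_support_energy[OF K \<psi>]] by simp
  moreover have "inner (embed (\<lambda>x. - dirichlet_laplacian K w x)) (embed ?\<psi>) = - inner (grad w) (grad ?\<psi>) / 2"
    by (rule inner_dirichlet_laplacian[OF K w \<psi>])
  ultimately have "inner e' (embed ?\<psi>) = - inner (grad u - grad w) (grad ?\<psi>) / 2"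
    by (simp add: e'_def inner_diff_left)
  moreover have "embed ?\<psi> = embed \<phi> - embed w" "grad ?\<psi> = grad \<phi> - grad w"
    using ell2_diff finite_energy_diff energy ell2 by auto
  ultimately have orth: "inner e' (embed \<phi> - embed w) = - inner (grad u - grad w) (grad \<phi> - grad w) / 2"
    by simp
  define g where "g = grad u - grad w"
  define a where "a = grad u - grad \<phi>"
  have "inner (embed u - embed w) e' = inner (embed u - embed \<phi>) e' + inner e' (embed \<phi> - embed w)"
    by (simp add: inner_diff_left inner_diff_right inner_commute)
  also have "\<dots> = inner (embed u - embed \<phi>) e' - inner g (g - a) / 2"
    unfolding orth by (simp add: g_def a_def)
  also have "\<dots> \<le> norm (embed u - embed \<phi>) * norm e' + (norm a)\<^sup>2 / 8"
  proof -
    have "0 \<le> inner (g - a /\<^sub>R 2) (g - a /\<^sub>R 2)" by simp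
    also have "\<dots> = inner g (g - a) + (norm a)\<^sup>2 / 4"
      by (simp add: inner_diff_left inner_diff_right inner_commute power2_norm_eq_inner)
    finally show ?thesis using norm_cauchy_schwarz[of "embed u - embed \<phi>" e'] by linarith
  qed
  finally show ?thesis by (simp add: a_def)
qed

text \<open>
  The energy estimate bounds the derivative of \<open>\<parallel>u - w\<parallel>\<^sup>2\<close> uniformly on \<open>[0, t]\<close> by a multiple of
  the approximation error \<open>\<delta>\<close>; here \<open>\<parallel>e'\<parallel> \<le> C\<close> independently of \<open>K\<close>.
\<close>
lemma galerkin:
  assumes A: "finite A" and supp: "\<And>x. x \<notin> A \<Longrightarrow> f x = 0" and t: "t > 0" and \<epsilon>: "\<epsilon> > 0"
  shows "\<exists>K w. finite K \<and> dirichlet_solution K w \<and> w 0 = f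
    \<and> norm (embed (T t f) - embed (w t)) < \<epsilon>"
proof -
  have f: "f \<in> lap_domain b m" by (rule finite_support_lap_domain[OF A supp])
  have ell2: "f \<in> ell2 m" "laplacian f \<in> ell2 m"
    using lap_domainD[OF f] dform_domainD(1) by auto
  have "continuous_on {0..t} (\<lambda>s. embed (T s (laplacian f)))"
    by (rule continuous_on_subset[OF continuous_on_embed_T[OF ell2(2)]]) simp
  then have "bounded ((\<lambda>s. embed (T s (laplacian f))) ` {0..t})"
    by (intro compact_imp_bounded compact_continuous_image) auto
  then obtain B where "\<forall>v \<in> (\<lambda>s. embed (T s (laplacian f))) ` {0..t}. norm v \<le> B"
    unfolding bounded_iff by blast
  then have B: "\<And>s. 0 \<le> s \<Longrightarrow> s \<le> t \<Longrightarrow> norm (embed (T s (laplacian f))) \<le> B" by simp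
  define C where "C = B + norm (embed (laplacian f))"
  have "B \<ge> 0" using B[of 0] t norm_ge_zero order_trans by (metis less_imp_le order_refl)
  then have C: "C \<ge> 0" by (simp add: C_def)
  define \<delta> where "\<delta> = min 1 (\<epsilon>\<^sup>2 / (2 * (2 * C + 1) * t))"
  have \<delta>: "\<delta> > 0" "\<delta> \<le> 1" using \<epsilon> C t by (simp_all add: \<delta>_def)
  have small: "(2 * C + 1) * \<delta> * t < \<epsilon>\<^sup>2"
  proof -
    have pos: "2 * (2 * C + 1) * t > 0" using C t by simp
    have "\<delta> \<le> \<epsilon>\<^sup>2 / (2 * (2 * C + 1) * t)" by (simp add: \<delta>_def)
    then have "\<delta> * (2 * (2 * C + 1) * t) \<le> \<epsilon>\<^sup>2" using pos by (simp add: pos_le_divide_eq)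
    moreover have "\<epsilon>\<^sup>2 > 0" using \<epsilon> by simp
    moreover have "\<delta> * (2 * (2 * C + 1) * t) = 2 * ((2 * C + 1) * \<delta> * t)" by simp
    ultimately show ?thesis by linarith
  qed
  obtain K0 where K0: "finite K0"
    "\<And>s. 0 \<le> s \<Longrightarrow> s \<le> t \<Longrightarrow> \<exists>\<phi>. (\<forall>x. x \<notin> K0 \<longrightarrow> \<phi> x = 0)
      \<and> norm (embed (T s f) - embed \<phi>) < \<delta> \<and> norm (grad (T s f) - grad \<phi>) < \<delta>"
    using uniform_finite_approximation[OF f \<delta>(1), of t] by blast
  (* K contains the neighbours of A so that cutting off to K does not change the Laplacian of f *)
  define K where "K = neighbourhood A \<union> K0"
  have K: "finite K" "A \<subseteq> K"
    using K0(1) finite_neighbourhood[OF A] by (auto simp: K_def neighbourhood_def)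
  obtain w where w: "dirichlet_solution K w" "w 0 = f"
    using dirichlet_solution_exists[OF K(1), of f] supp K(2) by blast
  let ?z = "\<lambda>s x. - dirichlet_laplacian K (w s) x"
  have w_supp: "\<And>s x. x \<notin> K \<Longrightarrow> w s x = 0" using w(1) by (simp add: dirichlet_solution_def)
  have z_bound: "norm (embed (?z s)) \<le> norm (embed (laplacian f))" if "s \<ge> 0" for s
  proof -
    have "?z 0 = (\<lambda>x. - laplacian f x)"
      using laplacian_finite_support[OF supp] by (auto simp: dirichlet_laplacian_def w(2) K_def)
    then show ?thesis
      using dirichlet_solution_norm_decreasing[OF K(1) dirichlet_solution_derivative[OF w(1)] that]
        ell2_uminus[OF ell2(2)] by simp
  qed
  define E where "E s = inner (embed (T s f) - embed (w s)) (embed (T s f) - embed (w s))" for s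
  define e' where "e' s = - embed (laplacian (T s f)) - embed (?z s)" for s
  have w_deriv: "((\<lambda>s. embed (w s)) has_vector_derivative embed (?z s)) (at s)" for s
    by (rule dirichlet_solution_has_vector_derivative[OF K(1) w(1)])
  have E_deriv: "(E has_real_derivative 2 * inner (embed (T s f) - embed (w s)) (e' s)) (at s)" if "s > 0" for s
  proof -
    have "((\<lambda>s. embed (T s f) - embed (w s)) has_vector_derivative e' s) (at s)"
      unfolding e'_def by (intro has_vector_derivative_diff heat_equation[OF f that] w_deriv)
    from bounded_bilinear.has_vector_derivative[OF bounded_bilinear_inner this this]
    show ?thesis
      unfolding has_real_derivative_iff_has_vector_derivative E_def by (simp add: inner_commute)
  qed
  have bound: "2 * inner (embed (T s f) - embed (w s)) (e' s) \<le> (2 * C + 1) * \<delta>" if s: "0 \<le> s" "s \<le> t" for s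
  proof -
    obtain \<phi> where \<phi>: "\<And>x. x \<notin> K0 \<Longrightarrow> \<phi> x = 0"
      "norm (embed (T s f) - embed \<phi>) < \<delta>" "norm (grad (T s f) - grad \<phi>) < \<delta>"
      using K0(2)[OF s] by blast
    have "norm (e' s) \<le> norm (- embed (laplacian (T s f))) + norm (embed (?z s))"
      unfolding e'_def by (rule norm_triangle_ineq4)
    then have e': "norm (e' s) \<le> C"
      using B[OF s] z_bound[OF s(1)] semigroup_laplacian(2)[OF f s(1)] by (simp add: C_def)
    have "inner (embed (T s f) - embed (w s)) (e' s)
        \<le> norm (embed (T s f) - embed \<phi>) * norm (e' s) + (norm (grad (T s f) - grad \<phi>))\<^sup>2 / 8"
      unfolding e'_def by (rule galerkin_energy[OF f s(1) K(1) w_supp]) (use \<phi>(1) K_def in auto)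
    moreover have "norm (embed (T s f) - embed \<phi>) * norm (e' s) \<le> \<delta> * C"
      using \<phi>(2) e' \<delta>(1) by (intro mult_mono) auto
    moreover have "(norm (grad (T s f) - grad \<phi>))\<^sup>2 \<le> \<delta>"
    proof -
      have "(norm (grad (T s f) - grad \<phi>))\<^sup>2 \<le> \<delta>\<^sup>2" using \<phi>(3) by (intro power_mono) auto
      also have "\<dots> \<le> \<delta>" using \<delta> by (simp add: power2_eq_square mult_left_le)
      finally show ?thesis .
    qed
    ultimately show ?thesis using \<delta>(1) by (simp add: algebra_simps)
  qed
  have "E t - (2 * C + 1) * \<delta> * t \<le> E 0 - (2 * C + 1) * \<delta> * 0"
  proof (rule DERIV_nonpos_imp_decreasing_open[of 0 t])
    fix s assume s: "0 < s" "s < t"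
    have "((\<lambda>s. E s - (2 * C + 1) * \<delta> * s) has_real_derivative
        2 * inner (embed (T s f) - embed (w s)) (e' s) - (2 * C + 1) * \<delta>) (at s)"
      by (rule derivative_eq_intros E_deriv s refl)+ simp
    then show "\<exists>y. ((\<lambda>s. E s - (2 * C + 1) * \<delta> * s) has_real_derivative y) (at s) \<and> y \<le> 0"
      using bound[of s] s by (intro exI conjI) auto
  next
    have "continuous_on {0..t} (\<lambda>s. embed (w s))"
      by (rule continuous_on_vector_derivative) (rule has_vector_derivative_at_within[OF w_deriv])
    then show "continuous_on {0..t} (\<lambda>s. E s - (2 * C + 1) * \<delta> * s)"
      unfolding E_def
      by (intro continuous_intros continuous_on_subset[OF continuous_on_embed_T[OF ell2(1)]]) auto
  qed (use t in simp)
  moreover have "E 0 = 0" using T_zero[OF ell2(1)] w(2) by (simp add: E_def)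
  ultimately have "E t < \<epsilon>\<^sup>2" using small by linarith
  then have "(norm (embed (T t f) - embed (w t)))\<^sup>2 < \<epsilon>\<^sup>2"
    by (simp add: E_def power2_norm_eq_inner)
  then have "norm (embed (T t f) - embed (w t)) < \<epsilon>"
    by (rule power_less_imp_less_base) (use \<epsilon> in simp)
  then show ?thesis using K(1) w by blast
qed

text \<open>
  The function \<open>s \<mapsto> \<langle>T s f, T (t - s) g\<rangle>\<close> has derivative zero because the form is symmetric.
\<close>
lemma semigroup_symmetric:
  assumes f: "f \<in> lap_domain b m" and g: "g \<in> lap_domain b m" and t: "t \<ge> 0"
  shows "inner (embed (T t f)) (embed g) = inner (embed f) (embed (T t g))"
proof (cases "t = 0")
  case False
  then have t: "t > 0" using t by simp
  have ell2: "f \<in> ell2 m" "g \<in> ell2 m"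
    using lap_domainD(1) dform_domainD(1) f g by auto
  let ?\<Psi> = "\<lambda>s. inner (embed (T s f)) (embed (T (t - s) g))"
  have "?\<Psi> t = ?\<Psi> 0"
  proof (rule DERIV_isconst_end[OF t])
    have "continuous_on {0..t} (\<lambda>s. embed (T (t - s) g))"
      by (rule continuous_on_compose2[OF continuous_on_embed_T[OF ell2(2)]]) (auto intro!: continuous_intros)
    then show "continuous_on {0..t} ?\<Psi>"
      by (intro continuous_on_inner continuous_on_subset[OF continuous_on_embed_T[OF ell2(1)]]) auto
    fix s assume s: "0 < s" "s < t"
    have "((\<lambda>s. t - s) has_vector_derivative -1) (at s)"
      by (auto intro!: derivative_eq_intros simp: has_real_derivative_iff_has_vector_derivative[symmetric])
    moreover have "t - s > 0" using s by simp
    ultimately have "((\<lambda>s. embed (T (t - s) g)) has_vector_derivative embed (laplacian (T (t - s) g))) (at s)"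
      using vector_diff_chain_at[OF _ heat_equation[OF g]] by (fastforce simp: o_def)
    from bounded_bilinear.has_vector_derivative[OF bounded_bilinear_inner heat_equation[OF f s(1)] this]
    have d: "(?\<Psi> has_vector_derivative
        inner (embed (T s f)) (embed (laplacian (T (t - s) g)))
        + inner (- embed (laplacian (T s f))) (embed (T (t - s) g))) (at s)" .
    have dom: "T s f \<in> lap_domain b m" "T (t - s) g \<in> lap_domain b m"
      using semigroup_laplacian(1) f g s by auto
    have "inner (embed (laplacian (T s f))) (embed (T (t - s) g)) = dform b (T s f) (T (t - s) g)"
      using lap_domainD(4)[OF dom(1) lap_domainD(1)[OF dom(2)]] by simp
    also have "\<dots> = dform b (T (t - s) g) (T s f)" by (simp add: dform_def mult_ac)
    also have "\<dots> = inner (embed (laplacian (T (t - s) g))) (embed (T s f))"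
      using lap_domainD(4)[OF dom(2) lap_domainD(1)[OF dom(1)]] by simp
    finally show "(?\<Psi> has_real_derivative 0) (at s)"
      using d by (simp add: has_real_derivative_iff_has_vector_derivative inner_commute)
  qed
  then show ?thesis using T_zero ell2 by simp
qed (use T_zero f g lap_domainD(1) dform_domainD(1) in auto)

lemma point_in_lap_domain: "point a \<in> lap_domain b m"
  by (rule finite_support_lap_domain[of "{a}"]) auto

lemma inner_point: "f \<in> ell2 m \<Longrightarrow> inner (embed (point a)) (embed f) = f a * m a"
  using finite_support_ell2(2)[of "{a}" "point a" f] ell2_inner_eq[OF point_in_ell2, of f a] by simp

text \<open>
  The kernel property, applied to the point mass at \<open>x\<close>, gives the value at \<open>a\<close> of the flow started at
  \<open>x\<close>. Symmetry exchanges the two vertices, so that all values \<open>p t a x\<close> are read off one flow.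
\<close>
lemma kernel_eq:
  assumes t: "t \<ge> 0"
    and kernel: "\<And>f x. f \<in> ell2 m \<Longrightarrow> ((\<lambda>y. p t x y * f y * m y) has_sum T t f x) UNIV"
  shows "p t a x = T t (point a) x / m a"
proof -
  have "((\<lambda>y. p t a y * point x y * m y) has_sum p t a x * m x) UNIV
      \<longleftrightarrow> ((\<lambda>y. p t a y * point x y * m y) has_sum p t a x * m x) {x}"
    by (rule has_sum_cong_neutral) auto
  then have "((\<lambda>y. p t a y * point x y * m y) has_sum p t a x * m x) UNIV"
    by (simp add: has_sum_finiteI)
  then have "T t (point x) a = p t a x * m x"
    by (rule has_sum_unique[OF kernel[OF point_in_ell2]])
  moreover have "T t (point x) a * m a = T t (point a) x * m x"
    using semigroup_symmetric[OF point_in_lap_domain point_in_lap_domain t, of a x]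
      inner_point[OF T_in_ell2[OF t point_in_ell2]] by (simp add: inner_commute)
  ultimately show ?thesis using measure_pos[of a] measure_pos[of x] by (simp add: field_simps)
qed

lemma heat_equation_pointwise:
  assumes f: "f \<in> lap_domain b m" and t: "t > 0"
  shows "((\<lambda>s. T s f x) has_real_derivative - laplacian (T t f) x) (at t)"
proof -
  have u: "T t f \<in> lap_domain b m" using semigroup_laplacian(1)[OF f] t by simp
  have "((\<lambda>s. l2_fun (embed (T s f)) x) has_vector_derivative
      l2_fun (- embed (laplacian (T t f))) x) (at t)"
    by (rule bounded_linear.has_vector_derivative[OF bounded_linear_l2_fun heat_equation[OF f t]])
  then have "((\<lambda>s. l2_fun (embed (T s f)) x / sqrt (m x)) has_real_derivative
      l2_fun (- embed (laplacian (T t f))) x / sqrt (m x)) (at t)"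
    unfolding has_real_derivative_iff_has_vector_derivative[symmetric] by (rule DERIV_cdivide)
  moreover have "l2_fun (- embed (laplacian (T t f))) x / sqrt (m x) = - laplacian (T t f) x"
    using sqrt_measure_pos[of x] lap_domainD(2)[OF u] by (simp add: uminus_l2.rep_eq l2_fun_embed)
  moreover have "\<forall>\<^sub>F s in nhds t. l2_fun (embed (T s f)) x / sqrt (m x) = T s f x"
  proof -
    have "\<forall>\<^sub>F s in nhds t. s \<in> {0<..}" by (rule eventually_nhds_in_open) (use t in auto)
    then show ?thesis
    proof eventually_elim
      case (elim s)
      then show "l2_fun (embed (T s f)) x / sqrt (m x) = T s f x"
        using sqrt_measure_pos[of x] T_in_ell2[of s f] dform_domainD(1)[OF lap_domainD(1)[OF f]]
        by (simp add: l2_fun_embed)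
    qed
  qed
  ultimately show ?thesis by (simp cong: DERIV_cong_ev)
qed

end

section \<open>Spheres, balls and radial functions\<close>

context weighted_graph
begin

lemma gdist_walk: "(x, y) \<in> edges b ^^ gdist b x y"
proof -
  obtain n where "(x, y) \<in> edges b ^^ n" using connected rtrancl_imp_relpow by blast
  then show ?thesis unfolding gdist_def by (rule LeastI)
qed

lemma gdist_le: "(x, y) \<in> edges b ^^ n \<Longrightarrow> gdist b x y \<le> n"
  unfolding gdist_def by (rule Least_le)

lemma gdist_eq_0_iff: "gdist b x y = 0 \<longleftrightarrow> x = y"
  using gdist_walk[of x y] gdist_le[of x y 0] by auto

lemma gdist_neighbour:
  assumes "b x y > 0"
  shows "gdist b x z \<le> Suc (gdist b y z)" and "gdist b y z \<le> Suc (gdist b x z)"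
proof -
  have "(x, y) \<in> edges b" "(y, x) \<in> edges b"
    using assms weight_sym[of x y] by (simp_all add: edges_def)
  then show "gdist b x z \<le> Suc (gdist b y z)" "gdist b y z \<le> Suc (gdist b x z)"
    by (auto intro!: gdist_le intro: relpow_Suc_I2 gdist_walk)
qed

lemma finite_gball: "finite {x. gdist b x z \<le> r}"
proof (induction r)
  case 0 then show ?case by (simp add: gdist_eq_0_iff)
next
  case (Suc r)
  have "{x. gdist b x z \<le> Suc r} \<subseteq> neighbourhood {x. gdist b x z \<le> r}"
  proof
    fix x assume "x \<in> {x. gdist b x z \<le> Suc r}"
    then consider "gdist b x z \<le> r" | "gdist b x z = Suc r" by fastforce
    then show "x \<in> neighbourhood {x. gdist b x z \<le> r}"
    proof cases
      case 2
      then obtain y where y: "(x, y) \<in> edges b" "(y, z) \<in> edges b ^^ r"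
        using gdist_walk[of x z] relpow_Suc_D2[of x z r "edges b"] by auto
      then have "b y x > 0" "gdist b y z \<le> r"
        using gdist_le weight_sym[of x y] by (auto simp: edges_def)
      then show ?thesis by (auto simp: neighbourhood_def)
    qed (simp add: neighbourhood_def)
  qed
  then show ?case using finite_subset finite_neighbourhood[OF Suc] by blast
qed

text \<open>
  The distance to \<open>x0\<close> changes by at most one along an edge, so the increments of a radial function
  involve the weights only through \<open>\<kappa>\<^sub>\<plusminus>\<close>. For \<open>r = 0\<close> the truncated \<open>r - 1\<close> is harmless: there
  \<open>\<kappa>\<^sub>-\<close> vanishes.
\<close>
lemma radial_sum:
  fixes g :: "nat \<Rightarrow> real" and x x0 :: 'v
  defines "r \<equiv> gdist b x x0"
  shows "(\<Sum>y | b x y > 0. b x y * (g (gdist b y x0) - g r)) / m x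
    = kappa_plus b m x0 x * (g (Suc r) - g r) + kappa_minus b m x0 x * (g (r - 1) - g r)"
proof -
  let ?F = "{y. gdist b y x0 \<le> Suc r}"
  let ?up = "\<lambda>y. if int (gdist b y x0) = int r + 1 then b x y * (g (Suc r) - g r) else 0"
  let ?down = "\<lambda>y. if int (gdist b y x0) = int r - 1 then b x y * (g (r - 1) - g r) else 0"
  have F: "finite ?F" by (rule finite_gball)
  have split: "b x y * (g (gdist b y x0) - g r) = ?up y + ?down y" for y
  proof (cases "b x y = 0")
    case False
    then have "gdist b y x0 \<le> Suc r" "r \<le> Suc (gdist b y x0)"
      using gdist_neighbour[of x y x0] by (auto simp: weight_pos_iff r_def)
    then consider "gdist b y x0 = Suc r" | "gdist b y x0 = r" | "Suc (gdist b y x0) = r" by linarith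
    then show ?thesis by cases auto
  qed simp
  have "(\<Sum>y | b x y > 0. b x y * (g (gdist b y x0) - g r)) = (\<Sum>y\<in>?F. b x y * (g (gdist b y x0) - g r))"
  proof (rule sum.mono_neutral_left[OF F])
    show "{y. b x y > 0} \<subseteq> ?F" using gdist_neighbour(2) by (auto simp: r_def)
  qed (use weight_pos_iff in auto)
  also have "\<dots> = (\<Sum>y\<in>?F. ?up y) + (\<Sum>y\<in>?F. ?down y)"
    unfolding split by (rule sum.distrib)
  also have "(\<Sum>y\<in>?F. ?up y) = (\<Sum>y\<in>gsphere b x0 (int r + 1). b x y * (g (Suc r) - g r))"
    by (rule sum.mono_neutral_cong_right[OF F]) (auto simp: gsphere_def)
  also have "(\<Sum>y\<in>?F. ?down y) = (\<Sum>y\<in>gsphere b x0 (int r - 1). b x y * (g (r - 1) - g r))"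
    by (rule sum.mono_neutral_cong_right[OF F]) (auto simp: gsphere_def)
  finally show ?thesis
    by (simp add: kappa_plus_def kappa_minus_def r_def sum_distrib_right add_divide_distrib)
qed

lemma kappa_nonneg: "kappa_plus b m x0 x \<ge> 0" "kappa_minus b m x0 x \<ge> 0"
  unfolding kappa_plus_def kappa_minus_def using measure_pos[of x]
  by (auto intro!: divide_nonneg_pos sum_nonneg weight_nonneg)

lemma laplacian_ge_radial:
  fixes g :: "nat \<Rightarrow> real" and x x0 :: 'v
  defines "r \<equiv> gdist b x x0"
  assumes "\<And>y. b x y > 0 \<Longrightarrow> u y - u x \<le> g (gdist b y x0) - g r"
  shows "- laplacian u x \<le> kappa_plus b m x0 x * (g (Suc r) - g r) + kappa_minus b m x0 x * (g (r - 1) - g r)"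
proof -
  have "- laplacian u x = (\<Sum>y | b x y > 0. b x y * (u y - u x)) / m x"
    by (simp add: laplacian_def sum_negf[symmetric] minus_divide_left right_diff_distrib)
  also have "\<dots> \<le> (\<Sum>y | b x y > 0. b x y * (g (gdist b y x0) - g r)) / m x"
    using measure_pos[of x] assms(2) weight_nonneg
    by (intro divide_right_mono sum_mono mult_left_mono) auto
  finally show ?thesis unfolding r_def radial_sum .
qed

lemma laplacian_uminus: "laplacian (\<lambda>x. - u x) x = - laplacian u x"
  by (simp add: laplacian_def sum_negf[symmetric] minus_divide_left right_diff_distrib)

lemma laplacian_le_radial:
  fixes g :: "nat \<Rightarrow> real" and x x0 :: 'v
  defines "r \<equiv> gdist b x x0"
  assumes "\<And>y. b x y > 0 \<Longrightarrow> u y - u x \<ge> g (gdist b y x0) - g r"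
  shows "- laplacian u x \<ge> kappa_plus b m x0 x * (g (Suc r) - g r) + kappa_minus b m x0 x * (g (r - 1) - g r)"
  using laplacian_ge_radial[of x "\<lambda>y. - u y" "\<lambda>n. - g n" x0] assms
  by (simp add: laplacian_uminus algebra_simps)

end

section \<open>Comparison of heat kernels\<close>

context heat_flow
begin

lemma continuous_on_pointwise:
  assumes f: "f \<in> ell2 m"
  shows "continuous_on {0..} (\<lambda>t. T t f x)"
proof -
  have "continuous_on {0..} (\<lambda>t. l2_fun (embed (T t f)) x / sqrt (m x))"
    using sqrt_measure_pos[of x] continuous_on_embed_T[OF f]
    by (intro continuous_on_divide bounded_linear.continuous_on[OF bounded_linear_l2_fun] continuous_on_const) auto
  moreover have "l2_fun (embed (T t f)) x / sqrt (m x) = T t f x" if "t \<in> {0..}" for t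
    using that sqrt_measure_pos[of x] T_in_ell2[of t f] f by (simp add: l2_fun_embed)
  ultimately show ?thesis by (rule continuous_on_eq)
qed

lemma galerkin_pointwise:
  assumes t: "t > 0" and \<epsilon>: "\<epsilon> > 0"
  shows "\<exists>K w. finite K \<and> dirichlet_solution K w \<and> w 0 = point a \<and> \<bar>T t (point a) x - w t x\<bar> < \<epsilon>"
proof -
  have supp: "\<And>x. x \<notin> {a} \<Longrightarrow> point a x = 0" by simp
  have "\<epsilon> * sqrt (m x) > 0" using \<epsilon> sqrt_measure_pos[of x] by simp
  then have "\<exists>K w. finite K \<and> dirichlet_solution K w \<and> w 0 = point a
      \<and> norm (embed (T t (point a)) - embed (w t)) < \<epsilon> * sqrt (m x)"
    by (intro galerkin[of "{a}"] supp t) simp_all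
  then obtain K w where K: "finite K" and w: "dirichlet_solution K w" "w 0 = point a"
    and near: "norm (embed (T t (point a)) - embed (w t)) < \<epsilon> * sqrt (m x)"
    by blast
  have "w t \<in> ell2 m" "T t (point a) \<in> ell2 m"
    using w finite_support_ell2(1)[OF K] T_in_ell2[OF _ point_in_ell2] t
    by (auto simp: dirichlet_solution_def)
  then have "l2_fun (embed (T t (point a)) - embed (w t)) x = (T t (point a) x - w t x) * sqrt (m x)"
    by (simp add: minus_l2.rep_eq l2_fun_embed left_diff_distrib)
  then have "\<bar>T t (point a) x - w t x\<bar> * sqrt (m x) = \<bar>l2_fun (embed (T t (point a)) - embed (w t)) x\<bar>"
    using sqrt_measure_pos[of x] by (simp add: abs_mult)
  also have "\<dots> \<le> norm (embed (T t (point a)) - embed (w t))" by (rule abs_l2_fun_le_norm)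
  also note near
  finally have "\<bar>T t (point a) x - w t x\<bar> < \<epsilon>"
    by (rule mult_right_less_imp_less) (use sqrt_measure_pos[of x] in simp)
  with K w show ?thesis by (intro exI[of _ K] exI[of _ w] conjI)
qed

text \<open>
  Positivity passes to the limit from the Dirichlet solutions.
\<close>
lemma T_point_nonneg:
  assumes "t \<ge> 0"
  shows "T t (point a) x \<ge> 0"
proof (cases "t = 0")
  case True then show ?thesis using T_zero[OF point_in_ell2] by simp
next
  case False
  then have t: "t > 0" using assms by simp
  show ?thesis
  proof (rule ccontr)
    assume neg: "\<not> T t (point a) x \<ge> 0"
    then have "- T t (point a) x > 0" by simp
    from galerkin_pointwise[OF t this, of a x]
    obtain K w where K: "finite K" and w: "dirichlet_solution K w" "w 0 = point a"
      and near: "\<bar>T t (point a) x - w t x\<bar> < - T t (point a) x"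
      by blast
    have "w t x \<ge> 0"
      by (rule dirichlet_solution_nonneg[OF K w(1)]) (use w(2) t in auto)
    then show False using near by linarith
  qed
qed

end

text \<open>
  The maximum principle for pairs \<open>(x, y)\<close> with \<open>y\<close> in the ball of radius \<open>|x|\<close>. Admitting the whole
  ball for \<open>y\<close>, instead of the sphere, builds the monotonicity in the radius into the comparison
  function.
\<close>
lemma dirichlet_solution_le_heat:
  fixes b :: "'v \<Rightarrow> 'v \<Rightarrow> real" and bs :: "'w \<Rightarrow> 'w \<Rightarrow> real"
  assumes G: "weighted_graph b m" and H: "heat_flow bs ms T"
    and plus: "\<And>x y. gdist b x x0 = gdist bs y z \<Longrightarrow> kappa_plus b m x0 x \<ge> kappa_plus bs ms z y"
    and minus: "\<And>x y. gdist b x x0 = gdist bs y z \<Longrightarrow> kappa_minus b m x0 x \<le> kappa_minus bs ms z y"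
    and K: "finite K" and w: "weighted_graph.dirichlet_solution b m K w" "w 0 = point x0"
    and t: "t \<ge> 0" and x: "x \<in> K" and y: "gdist bs y z \<le> gdist b x x0"
  shows "w t x \<le> T t (point z) y"
proof -
  interpret G: weighted_graph b m by (rule G)
  interpret H: heat_flow bs ms T by (rule H)
  define I where "I = (SIGMA x:K. {y. gdist bs y z \<le> gdist b x x0})"
  define v where "v s y = T s (point z) y" for s y
  define D where "D = (\<lambda>(x, y) s. v s y - w s x)"
  define D' where "D' = (\<lambda>(x, y) s. - H.laplacian (v s) y + G.laplacian (w s) x)"
  have v_nonneg: "v s y \<ge> 0" if "s \<ge> 0" for s y unfolding v_def by (rule H.T_point_nonneg[OF that])
  have w_deriv: "((\<lambda>s. w s x) has_real_derivative - G.dirichlet_laplacian K (w s) x) (at s)" for s x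
    using w(1) by (simp add: G.dirichlet_solution_def)
  have w_out: "w s x = 0" if "x \<notin> K" for s x
    using w(1) that by (simp add: G.dirichlet_solution_def)
  have "D (x, y) t \<ge> 0"
  proof (rule first_touching[where D = D and D' = D' and I = I])
    show "finite I" unfolding I_def using K H.finite_gball by blast
    show "(x, y) \<in> I" using x y by (simp add: I_def)
    show "t \<ge> 0" by (rule t)
  next
    fix i assume "i \<in> I"
    have "continuous_on {0..} (\<lambda>s. w s x)" for x
      by (rule DERIV_continuous_on) (rule DERIV_subset[OF w_deriv], simp)
    then show "continuous_on {0..} (D i)"
      unfolding D_def v_def case_prod_unfold
      by (intro continuous_on_diff H.continuous_on_pointwise H.point_in_ell2)
    obtain x y where i: "i = (x, y)" "x \<in> K" "gdist bs y z \<le> gdist b x x0"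
      using \<open>i \<in> I\<close> by (auto simp: I_def)
    have "v 0 y = point z y" unfolding v_def using H.T_zero[OF H.point_in_ell2] by simp
    moreover have "y = z" if "x = x0" using i(3) that G.gdist_eq_0_iff[of x0 x0] H.gdist_eq_0_iff[of y z] by simp
    ultimately show "D i 0 \<ge> 0" by (simp add: D_def i(1) w(2))
  next
    fix i and s :: real assume "i \<in> I" and s: "s > 0"
    then obtain x y where i: "i = (x, y)" "x \<in> K" by (auto simp: I_def)
    have "((\<lambda>s. v s y) has_real_derivative - H.laplacian (v s) y) (at s)"
      unfolding v_def by (rule H.heat_equation_pointwise[OF H.point_in_lap_domain s])
    from DERIV_diff[OF this w_deriv[of x s]]
    show "(D i has_real_derivative D' i s) (at s)"
      using i(2) by (simp add: D_def D'_def i(1) G.dirichlet_laplacian_def)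
  next
    fix i and s :: real
    assume "i \<in> I" and s: "s > 0" and neg: "D i s < 0" and min: "\<And>j. j \<in> I \<Longrightarrow> D i s \<le> D j s"
    then obtain x y where i: "i = (x, y)" "x \<in> K" "gdist bs y z \<le> gdist b x x0" by (auto simp: I_def)
    define c where "c = w s x - v s y"
    have c: "c > 0" using neg by (simp add: c_def D_def i(1))
    have min': "w s x' \<le> v s y' + c" if "x' \<in> K" "gdist bs y' z \<le> gdist b x' x0" for x' y'
      using min[of "(x', y')"] that by (simp add: I_def D_def i(1) c_def)
    define r where "r = gdist b x x0"
    define B where "B n = {y. gdist bs y z \<le> n}" for n
    have B: "finite (B n)" "z \<in> B n" for n
      using H.finite_gball by (simp_all add: B_def H.gdist_eq_0_iff[THEN iffD2])
    (* g is the largest decreasing radial function below v s *)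
    define g where "g n = Min (v s ` B n)" for n
    have g_le: "g n \<le> v s y'" if "gdist bs y' z \<le> n" for n y'
      unfolding g_def using B that by (intro Min_le) (auto simp: B_def)
    have le_g: "a \<le> g n" if "\<And>y'. gdist bs y' z \<le> n \<Longrightarrow> a \<le> v s y'" for a n
      unfolding g_def using B[of n] that by (intro Min.boundedI) (auto simp: B_def)
    (* minimality of (x, y) among the pairs (x, y') says that y minimises v s over the ball *)
    have g_r: "g r = v s y"
    proof (rule antisym)
      show "g r \<le> v s y" using g_le i(3) by (simp add: r_def)
      show "v s y \<le> g r" by (rule le_g) (use min'[OF i(2)] in \<open>simp add: c_def r_def\<close>)
    qed
    have g_anti: "g n' \<le> g n" if "n \<le> n'" for n n'
      by (rule le_g) (use g_le that in \<open>meson order_trans\<close>)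
    have up: "g (Suc r) - g r \<le> 0" and down: "g (r - 1) - g r \<ge> 0"
      using g_anti[of r "Suc r"] g_anti[of "r - 1" r] by simp_all
    (* minimality among the pairs (x', y') says w s \<le> g + c on K; outside K this holds since w s = 0 *)
    have "- G.laplacian (w s) x
        \<le> kappa_plus b m x0 x * (g (Suc r) - g r) + kappa_minus b m x0 x * (g (r - 1) - g r)"
      unfolding r_def
    proof (rule G.laplacian_ge_radial)
      fix x' assume "b x x' > 0"
      have "w s x' \<le> g (gdist b x' x0) + c"
      proof (cases "x' \<in> K")
        case True
        have "w s x' - c \<le> g (gdist b x' x0)"
          by (rule le_g) (use min'[OF True] in \<open>simp add: diff_le_eq\<close>)
        then show ?thesis by simp
      next
        case False
        have "0 \<le> g (gdist b x' x0)" by (rule le_g) (use v_nonneg s in simp)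
        then show ?thesis using w_out[OF False] c by simp
      qed
      then show "w s x' - w s x \<le> g (gdist b x' x0) - g (gdist b x x0)"
        using g_r by (simp add: c_def r_def)
    qed
    moreover have "kappa_plus b m x0 x * (g (Suc r) - g r) + kappa_minus b m x0 x * (g (r - 1) - g r)
        \<le> - H.laplacian (v s) y"
    proof (cases "gdist bs y z = r")
      case True
      have "kappa_plus b m x0 x * (g (Suc r) - g r) \<le> kappa_plus bs ms z y * (g (Suc r) - g r)"
        using plus[of x y] True up by (intro mult_right_mono_neg) (simp_all add: r_def)
      moreover have "kappa_minus b m x0 x * (g (r - 1) - g r) \<le> kappa_minus bs ms z y * (g (r - 1) - g r)"
        using minus[of x y] True down by (intro mult_right_mono) (simp_all add: r_def)
      moreover have "kappa_plus bs ms z y * (g (Suc r) - g r) + kappa_minus bs ms z y * (g (r - 1) - g r)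
          \<le> - H.laplacian (v s) y"
        unfolding True[symmetric]
        by (rule H.laplacian_le_radial) (use g_r True g_le in \<open>simp add: diff_right_mono\<close>)
      ultimately show ?thesis by linarith
    next
      case False
      then have y: "gdist bs y z \<le> r - 1" "Suc (gdist bs y z) \<le> r" using i(3) by (simp_all add: r_def)
      have "g (r - 1) - g r \<le> 0" using g_le[OF y(1)] g_r by simp
      then have "kappa_plus b m x0 x * (g (Suc r) - g r) + kappa_minus b m x0 x * (g (r - 1) - g r) \<le> 0"
        using up G.kappa_nonneg by (intro add_nonpos_nonpos mult_nonneg_nonpos)
      moreover have "H.laplacian (v s) y \<le> 0"
      proof (rule H.laplacian_nonpos)
        fix y' assume "bs y y' > 0"
        then have "gdist bs y' z \<le> r" using H.gdist_neighbour(2)[of y y' z] y(2) by simp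
        then show "v s y \<le> v s y'" using g_le g_r by metis
      qed
      ultimately show ?thesis by linarith
    qed
    ultimately show "D' i s \<ge> 0" by (simp add: D'_def i(1))
  qed
  then show ?thesis by (simp add: D_def v_def)
qed

text \<open>
  If the inequality failed at some \<open>(x, y)\<close>, it would fail for a Dirichlet solution that is close
  enough to the flow at \<open>x\<close>.
\<close>
lemma heat_comparison:
  fixes b :: "'v \<Rightarrow> 'v \<Rightarrow> real" and bs :: "'w \<Rightarrow> 'w \<Rightarrow> real"
  assumes G: "heat_flow b m T" and H: "heat_flow bs ms Ts"
    and plus: "\<And>x y. gdist b x x0 = gdist bs y z \<Longrightarrow> kappa_plus b m x0 x \<ge> kappa_plus bs ms z y"
    and minus: "\<And>x y. gdist b x x0 = gdist bs y z \<Longrightarrow> kappa_minus b m x0 x \<le> kappa_minus bs ms z y"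
    and t: "t \<ge> 0" and xy: "gdist b x x0 = gdist bs y z"
  shows "T t (point x0) x \<le> Ts t (point z) y"
proof -
  interpret G: heat_flow b m T by (rule G)
  interpret H: heat_flow bs ms Ts by (rule H)
  show ?thesis
  proof (cases "t = 0")
    case True
    have "x = x0 \<longleftrightarrow> y = z" using xy G.gdist_eq_0_iff[of x x0] H.gdist_eq_0_iff[of y z] by simp
    then show ?thesis using True G.T_zero[OF G.point_in_ell2] H.T_zero[OF H.point_in_ell2] by simp
  next
    case False
    show ?thesis
    proof (rule ccontr)
      assume gap: "\<not> ?thesis"
      have "t > 0" "T t (point x0) x - Ts t (point z) y > 0" using t False gap by simp_all
      from G.galerkin_pointwise[OF this, of x0 x]
      obtain K w where K: "finite K" and w: "G.dirichlet_solution K w" "w 0 = point x0"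
        and near: "\<bar>T t (point x0) x - w t x\<bar> < T t (point x0) x - Ts t (point z) y"
        by blast
      have "w t x \<le> Ts t (point z) y"
      proof (cases "x \<in> K")
        case True
        show ?thesis
          by (rule dirichlet_solution_le_heat[OF G.weighted_graph_axioms H plus minus K w t True])
            (use xy in simp_all)
      next
        case False
        then show ?thesis using w(1) H.T_point_nonneg[OF t] by (simp add: G.dirichlet_solution_def)
      qed
      then show False using near by linarith
    qed
  qed
qed

lemma heat_kernel_comparison:
  fixes b :: "'v \<Rightarrow> 'v \<Rightarrow> real" and bs :: "'w \<Rightarrow> 'w \<Rightarrow> real"
  assumes G: "weighted_graph b m" "heat_kernel b m p"
    and H: "weighted_graph bs ms" "heat_kernel bs ms ps"
    and growth: "stronger_curvature_growth b m x0 bs ms z"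
    and x: "x \<in> gsphere b x0 (int r)" and y: "y \<in> gsphere bs z (int r)" and t: "t \<ge> 0"
  shows "p t x0 x \<le> ps t z y"
proof -
  obtain T where T: "heat_semigroup b m T"
    "\<And>t f x. t \<ge> 0 \<Longrightarrow> f \<in> ell2 m \<Longrightarrow> ((\<lambda>y. p t x y * f y * m y) has_sum T t f x) UNIV"
    using G(2) unfolding heat_kernel_def by blast
  obtain Ts where Ts: "heat_semigroup bs ms Ts"
    "\<And>t f x. t \<ge> 0 \<Longrightarrow> f \<in> ell2 ms \<Longrightarrow> ((\<lambda>y. ps t x y * f y * ms y) has_sum Ts t f x) UNIV"
    using H(2) unfolding heat_kernel_def by blast
  interpret G: heat_flow b m T by (intro heat_flow.intro heat_flow_axioms.intro G(1) T(1))
  interpret H: heat_flow bs ms Ts by (intro heat_flow.intro heat_flow_axioms.intro H(1) Ts(1))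
  have m: "m x0 = ms z" using growth by (simp add: stronger_curvature_growth_def)
  have kappa: "kappa_plus bs ms z y \<le> kappa_plus b m x0 x \<and> kappa_minus b m x0 x \<le> kappa_minus bs ms z y"
    if "gdist b x x0 = gdist bs y z" for x y
    using growth that by (simp add: stronger_curvature_growth_def gsphere_def)
  have "T t (point x0) x \<le> Ts t (point z) y"
    by (rule heat_comparison[OF G.heat_flow_axioms H.heat_flow_axioms])
      (use kappa t x y in \<open>simp_all add: gsphere_def\<close>)
  then have "T t (point x0) x / m x0 \<le> Ts t (point z) y / ms z"
    using G.measure_pos[of x0] m by (simp add: divide_right_mono)
  then show ?thesis using G.kernel_eq[of t p, OF t T(2)[OF t]] H.kernel_eq[of t ps, OF t Ts(2)[OF t]] by simp
qed

theorem theorem2: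
  fixes b :: "'v \<Rightarrow> 'v \<Rightarrow> real" and m :: "'v \<Rightarrow> real" and x0 :: 'v
    and bs :: "'w \<Rightarrow> 'w \<Rightarrow> real" and ms :: "'w \<Rightarrow> real" and z :: 'w
    and p :: "real \<Rightarrow> 'v \<Rightarrow> 'v \<Rightarrow> real" and ps :: "real \<Rightarrow> 'w \<Rightarrow> 'w \<Rightarrow> real"
  assumes "weighted_graph b m" and "heat_kernel b m p"
    and "weakly_spherically_symmetric bs ms z" and "heat_kernel bs ms ps"
  shows "(stronger_curvature_growth b m x0 bs ms z \<longrightarrow>
            (\<forall>r::nat. \<forall>x\<in>gsphere b x0 (int r). \<forall>y\<in>gsphere bs z (int r). \<forall>t\<ge>0.
               ps t z y \<ge> p t x0 x))
       \<and> (weaker_curvature_growth b m x0 bs ms z \<longrightarrow>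
            (\<forall>r::nat. \<forall>x\<in>gsphere b x0 (int r). \<forall>y\<in>gsphere bs z (int r). \<forall>t\<ge>0.
               ps t z y \<le> p t x0 x))"
proof -
  have sym: "weighted_graph bs ms" using assms(3) by (simp add: weakly_spherically_symmetric_def)
  have swap: "weaker_curvature_growth b m x0 bs ms z \<longleftrightarrow> stronger_curvature_growth bs ms z b m x0"
    unfolding weaker_curvature_growth_def stronger_curvature_growth_def by auto
  show ?thesis
    using heat_kernel_comparison[OF assms(1,2) sym assms(4)]
      heat_kernel_comparison[OF sym assms(4,1,2)] unfolding swap by blast
qed

end
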